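(* Let $k\ge 2$. Let $\lambda$ be the dominant root of the polynomial $X^k-\sum_{j=0}^{k-1}X^j$, and for all $l\in\mathcal{A}_k$ let $$v_l=\frac{1}{\lambda^{k-1-l}}\sum_{j=0}^{k-1-l}\lambda^j .$$ Then there exists $U\in\mathcal{C}(\mathcal{A}_k^{\mathbb{N}},\mathbb{R}_+)$ such that $RU=U$, given by $$\forall x\in\mathcal{A}_k^{\mathbb{N}},\quad U(x)=\log\left(1+\frac{v_{x_0}}{\frac{\lambda}{\lambda-1}+\sum_{l\in\mathcal{A}_k}v_l\,|x_{[0..\delta_{s_k}(x)-1]}|_l-v_{x_0}}\right).$$ Moreover, if $V:\mathcal{A}_k^{\mathbb{N}}\to\mathbb{R}_+$ is of the form $$\forall x\in\mathcal{A}_k^{\mathbb{N}},\quad V(x)=\frac{g(x)}{\delta_{s_k}(x)^\alpha}+\frac{h(x)}{\delta_{s_k}(x)^\alpha},$$ where $g$ is a positive continuous function on $\mathcal{A}_k^{\mathbb{N}}$, $h$ is a continuous real function on $\mathcal{A}_k^{\mathbb{N}}$ which is $0$ on $\Sigma_{s_k}$, and $\alpha>0$, then for any $x\in\mathcal{A}_k^{\mathbb{N}}\setminus\Sigma_{s_k}$: $$\lim_{n\to+\infty}R^nV(x)=\begin{cases}0&\text{if }\alpha>1,\\ +\infty&\text{if }\alpha<1,\\ \left(\int g\,d\mu\right)\cdot U(x)&\text{if }\alpha=1,\end{cases}$$ where $\mu$ is the only ergodic probability measure on $\Sigma_{s_k}$ (for the shift).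
   Context: $\mathcal{A}_k=\{0,1,\dots,k-1\}$; $\mathcal{A}_k^*$ is the free monoid of finite words over $\mathcal{A}_k$; $\mathcal{A}_k^{\mathbb{N}}$ is the set of one-sided infinite sequences $x=x_0x_1x_2\dots$ with the product topology, compatible with the distance $d(x,y)=2^{-\min\{n\in\mathbb{N}\,:\,x_n\ne y_n\}}$ for $x\neq y$. For a word $w$, $|w|$ is its length and $|w|_a$ the number of occurrences of the letter $a$ in $w$; $x_{[0..m]}=x_0x_1\dots x_m$. The shift is $\sigma(x_0x_1x_2\dots)=x_1x_2\dots$. The $k$-bonacci substitution $s_k$ is the morphism of $\mathcal{A}_k^*$ defined by $s_k(a)=0(a+1)$ (the two-letter word with letters $0$ and $a+1$) for $a\in\mathcal{A}_k\setminus\{k-1\}$ and $s_k(k-1)=0$; it extends to $\mathcal{A}_k^{\mathbb{N}}$ by concatenation. Let $\omega=\lim_{n\to+\infty}s_k^n(0)\in\mathcal{A}_k^{\mathbb{N}}$ and let $\Sigma_{s_k}$ be the closure of the orbit $\{\sigma^n(\omega):n\in\mathbb{N}\}$; the system $(\Sigma_{s_k},\sigma)$ is uniquely ergodic. For $x\in\mathcal{A}_k^{\mathbb{N}}\setminus\Sigma_{s_k}$, $\delta_{s_k}(x)$ is defined by $d(x,\Sigma_{s_k})=2^{-\delta_{s_k}(x)}$; for $x\in\Sigma_{s_k}$, $\delta_{s_k}(x)=+\infty$. When $\delta_{s_k}(x)=+\infty$, the conventions are $1/\delta_{s_k}(x)^\alpha=0$ and $U(x)=0$ (the denominator in the formula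 for $U$ being $+\infty$). The renormalization operator $R:\mathcal{C}(\mathcal{A}_k^{\mathbb{N}},\mathbb{R})\to\mathcal{C}(\mathcal{A}_k^{\mathbb{N}},\mathbb{R})$ is defined by $$(RV)(x)=\sum_{j=0}^{|s_k(x_0)|-1}V\circ\sigma^j\circ s_k(x).$$ *)

theory Defs
  imports
    "HOL-Probability.Probability"
    "HOL-Computational_Algebra.Polynomial"
    "HOL-Library.Extended_Nat"
begin

text \<open>
  Letters are natural numbers, finite words are lists, and one-sided sequences are functions
  \<^typ>\<open>nat \<Rightarrow> nat\<close>.  All topological notions refer to the product topology on
  \<^typ>\<open>nat \<Rightarrow> nat\<close> (with \<^typ>\<open>nat\<close> discrete), in which the set of sequences over a
  \<open>k\<close>-letter alphabet is closed.
\<close>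

definition seqs :: "nat \<Rightarrow> (nat \<Rightarrow> nat) set" where
  "seqs k = {x. \<forall>n. x n < k}"

definition shift_seq :: "(nat \<Rightarrow> nat) \<Rightarrow> nat \<Rightarrow> nat" where
  "shift_seq x = (\<lambda>n. x (Suc n))"

definition word_dist :: "(nat \<Rightarrow> nat) \<Rightarrow> (nat \<Rightarrow> nat) \<Rightarrow> real" where
  "word_dist x y = (if x = y then 0 else (1/2) ^ (LEAST n. x n \<noteq> y n))"

definition subst_letter :: "nat \<Rightarrow> nat \<Rightarrow> nat list" where
  "subst_letter k a = (if a = k - 1 then [0] else [0, a + 1])"

definition subst_word :: "nat \<Rightarrow> nat list \<Rightarrow> nat list" where
  "subst_word k w = concat (map (subst_letter k) w)"

text \<open>
  Images of letters are nonempty, so the image of the first \<open>n + 1\<close> letters of \<open>x\<close> has length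
  at least \<open>n + 1\<close> and determines the \<open>n\<close>-th letter of the infinite concatenation.
\<close>

definition subst_seq :: "nat \<Rightarrow> (nat \<Rightarrow> nat) \<Rightarrow> nat \<Rightarrow> nat" where
  "subst_seq k x = (\<lambda>n. subst_word k (map x [0..<Suc n]) ! n)"

text \<open>
  The limit of the words \<open>s\<^sub>k\<^sup>m(0)\<close>, letter by letter.  The lengths of these words tend to
  infinity, so for each \<open>n\<close> the out-of-range accesses concern only finitely many \<open>m\<close>.
\<close>

definition omega :: "nat \<Rightarrow> nat \<Rightarrow> nat" where
  "omega k = (\<lambda>n. lim (\<lambda>m. ((subst_word k ^^ m) [0]) ! n))"

definition subst_space :: "nat \<Rightarrow> (nat \<Rightarrow> nat) set" where
  "subst_space k = closure {(shift_seq ^^ n) (omega k) | n. True}"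

text \<open>
  For \<open>x\<close> outside the (closed) subshift the distance to it is attained and positive, hence of
  the form \<open>2\<^sup>-\<^sup>n\<close> with \<open>n\<close> a natural number.
\<close>

definition delta :: "nat \<Rightarrow> (nat \<Rightarrow> nat) \<Rightarrow> enat" where
  "delta k x = (if x \<in> subst_space k then \<infinity>
     else enat (THE n. (INF y\<in>subst_space k. word_dist x y) = (1/2) ^ n))"

definition inv_delta_powr :: "nat \<Rightarrow> real \<Rightarrow> (nat \<Rightarrow> nat) \<Rightarrow> real" where
  "inv_delta_powr k \<alpha> x = (case delta k x of enat m \<Rightarrow> 1 / real m powr \<alpha> | \<infinity> \<Rightarrow> 0)"

definition renorm :: "nat \<Rightarrow> ((nat \<Rightarrow> nat) \<Rightarrow> real) \<Rightarrow> (nat \<Rightarrow> nat) \<Rightarrow> real" where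
  "renorm k V x = (\<Sum>j<length (subst_letter k (x 0)). V ((shift_seq ^^ j) (subst_seq k x)))"

definition kbonacci_poly :: "nat \<Rightarrow> complex poly" where
  "kbonacci_poly k = monom 1 k - (\<Sum>j<k. monom 1 j)"

definition dominant_root :: "complex poly \<Rightarrow> complex \<Rightarrow> bool" where
  "dominant_root p z \<longleftrightarrow> poly p z = 0 \<and> (\<forall>w. poly p w = 0 \<and> w \<noteq> z \<longrightarrow> cmod w < cmod z)"

definition letter_weight :: "nat \<Rightarrow> real \<Rightarrow> nat \<Rightarrow> real" where
  "letter_weight k \<beta> l = 1 / \<beta> ^ (k - 1 - l) * (\<Sum>j=0..k - 1 - l. \<beta> ^ j)"

definition ergodic_prob_on ::
    "'a::topological_space set \<Rightarrow> ('a \<Rightarrow> 'a) \<Rightarrow> 'a measure \<Rightarrow> bool" where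
  "ergodic_prob_on S T M \<longleftrightarrow>
     prob_space M \<and> sets M = sets (restrict_space borel S) \<and>
     T \<in> measurable M M \<and> distr M M T = M \<and>
     (\<forall>A\<in>sets M. T -` A \<inter> space M = A \<longrightarrow> measure M A = 0 \<or> measure M A = 1)"

end

theory Submission imports Defs begin

text \<open>
  Write \<open>s\<close> for the substitution, \<open>R\<close> for the renormalization operator, \<open>v\<close> for the letter weights.
  By concatenation of images, \<open>R\<^sup>n V x\<close> is the sum of \<open>V\<close> over the points \<open>\<sigma>\<^sup>j (s\<^sup>n x)\<close> where \<open>j\<close> runs
  through the \<open>N\<^sub>n\<close> positions of the \<open>s\<^sup>n\<close>-image of the first letter of \<open>x\<close>
  (\<open>renorm_pow_eq_birkhoff\<close>). Three facts determine its limit.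

  \<^item> The substitution is recognizable: in \<open>\<omega>\<close>, the letters \<open>0\<close> mark the beginnings of the images of
    letters, and a letter \<open>a + 1\<close> occurs only as the second letter of the image of \<open>a\<close>. Hence the longest
    legal prefix \<open>w\<close> of a sequence becomes \<open>s(w)0\<close> under \<open>s\<close>, and shifting inside the first block
    shortens it by one letter at a time: \<open>\<delta>(\<sigma>\<^sup>j (s\<^sup>n x)) = D\<^sub>n - j\<close> (\<open>exits_at_iterate\<close>). For
    \<open>V = (g + h) / \<delta>\<^sup>\<alpha>\<close> this gives \<open>R\<^sup>n V x = \<Sum>j<N\<^sub>n. (g + h)(\<sigma>\<^sup>j (s\<^sup>n x)) / (D\<^sub>n - j)\<^sup>\<alpha>\<close>.

  \<^item> The weights are an eigenvector: \<open>v(s(a)) = \<beta> v(a)\<close>. Thus the weight of the block is \<open>\<beta>\<^sup>n\<close> times the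
    weight of \<open>x 0\<close>, and \<open>A = \<beta> / (\<beta> - 1) + v(w)\<close> is multiplied by \<open>\<beta>\<close> under \<open>s\<close>. The function \<open>U\<close> equals
    \<open>ln (A / (A - v(x 0)))\<close>, so \<open>R U = U\<close> is a telescoping identity (\<open>renorm_fixed_potential\<close>).

  \<^item> Averages over blocks converge uniformly (\<open>renorm_pow_asymptotics\<close>). All images begin with \<open>0\<close>, so
    the ratios \<open>R\<^sup>n g / (\<beta>\<^sup>n v)\<close> are convex combinations in which a fixed proportion is common to all \<open>x\<close>
    up to a vanishing error, and their oscillation contracts. Cutting orbits into blocks transfers this to Birkhoff sums and
    identifies the average as \<open>\<integral> g d\<mu>\<close> for every invariant probability \<open>\<mu>\<close> (\<open>integral_null_mean\<close>).

  Applied to \<open>g = 1\<close>, the last fact shows that lengths are asymptotically proportional to weights, so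
  \<open>N\<^sub>n / \<beta>\<^sup>n\<close> and \<open>D\<^sub>n / \<beta>\<^sup>n\<close> converge to \<open>c v(x 0)\<close> and \<open>c A\<close> (\<open>growth\<close>). The cases \<open>\<alpha> \<noteq> 1\<close> follow by
  counting terms. For \<open>\<alpha> = 1\<close> the harmonic sum \<open>\<Sum>j<N\<^sub>n. 1 / (D\<^sub>n - j)\<close> tends to \<open>ln (A / (A - v(x 0)))\<close>,
  which is \<open>U x\<close>; summation by parts replaces \<open>g\<close> by its mean, and \<open>h\<close> is uniformly small on the block
  because \<open>D\<^sub>n - N\<^sub>n\<close> tends to infinity.
\<close>

section \<open>Sequences with long common prefixes\<close>

definition agree :: "nat \<Rightarrow> (nat \<Rightarrow> nat) \<Rightarrow> (nat \<Rightarrow> nat) \<Rightarrow> bool" where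
  "agree n x y \<longleftrightarrow> (\<forall>i<n. x i = y i)"

lemma agree_mono: "agree n x y \<Longrightarrow> m \<le> n \<Longrightarrow> agree m x y"
  by (auto simp: agree_def)

lemma agree_sym: "agree n x y \<Longrightarrow> agree n y x"
  by (auto simp: agree_def)

lemma agree_trans: "agree n x y \<Longrightarrow> agree n y z \<Longrightarrow> agree n x z"
  by (auto simp: agree_def)

lemma shift_seq_pow: "(shift_seq ^^ j) x = (\<lambda>n. x (j + n))"
  by (induction j) (auto simp: shift_seq_def fun_eq_iff)

lemma shift_seq_pow_add: "(shift_seq ^^ (i + j)) x = (shift_seq ^^ j) ((shift_seq ^^ i) x)"
  by (auto simp: shift_seq_pow fun_eq_iff add.assoc)

lemma agree_shift:
  "agree n x y \<Longrightarrow> agree (n - j) ((shift_seq ^^ j) x) ((shift_seq ^^ j) y)"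
  by (auto simp: agree_def shift_seq_pow)

lemma open_cylinder: "open {y. agree n x y}"
proof -
  have "{y. agree n x y} = (\<Inter>i\<in>{..<n}. (\<lambda>y. y i) -` {x i})" by (auto simp: agree_def)
  moreover have "open ((\<lambda>y::nat \<Rightarrow> nat. y i) -` {x i})" for i
    by (rule open_vimage[OF Topological_Spaces.open_discrete continuous_on_product_coordinates])
  ultimately show ?thesis by auto
qed

text \<open>Only finitely many coordinates are constrained by a basic open set of the product topology.\<close>

lemma open_contains_cylinder:
  assumes "open U" "x \<in> U"
  obtains n where "\<And>y. agree n x y \<Longrightarrow> y \<in> U"
proof -
  have "openin (product_topology (\<lambda>_::nat. euclidean :: nat topology) UNIV) U"
    using assms(1) by (simp add: euclidean_product_topology)
  from product_topology_open_contains_basis[OF this assms(2)]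
  obtain X where X: "x \<in> PiE UNIV X" "finite {i. X i \<noteq> UNIV}" "PiE UNIV X \<subseteq> U"
    by auto
  obtain n where n: "\<And>i. i \<in> {i. X i \<noteq> UNIV} \<Longrightarrow> i < n"
    using X(2) unfolding finite_nat_set_iff_bounded by blast
  have "y \<in> U" if "agree n x y" for y
  proof -
    have "y i \<in> X i" for i
    proof (cases "X i = UNIV")
      case False
      hence "x i = y i" using n[of i] that by (simp add: agree_def)
      moreover have "x i \<in> X i" using X(1) by (simp add: PiE_iff)
      ultimately show ?thesis by simp
    qed simp
    thus ?thesis using X(3) by (auto simp: PiE_iff)
  qed
  thus ?thesis by (rule that)
qed

lemma closure_iff_agree: "x \<in> closure A \<longleftrightarrow> (\<forall>n. \<exists>a\<in>A. agree n x a)"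
proof
  assume x: "x \<in> closure A"
  show "\<forall>n. \<exists>a\<in>A. agree n x a"
  proof
    fix n
    have "{y. agree n x y} \<inter> A \<noteq> {}"
      using x open_Int_closure_eq_empty[OF open_cylinder[of n x], of A]
      by (auto simp: agree_def)
    thus "\<exists>a\<in>A. agree n x a" by blast
  qed
next
  assume *: "\<forall>n. \<exists>a\<in>A. agree n x a"
  show "x \<in> closure A"
  proof (rule ccontr)
    assume "x \<notin> closure A"
    then obtain n where "\<And>y. agree n x y \<Longrightarrow> y \<in> - closure A"
      using open_contains_cylinder[of "- closure A" x] by auto
    moreover obtain a where "a \<in> A" "agree n x a" using * by blast
    ultimately show False using closure_subset by blast
  qed
qed

lemma compact_seqs: "compact (seqs k)"
proof -
  have "seqs k = PiE UNIV (\<lambda>_. {..<k})" by (auto simp: seqs_def)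
  moreover have "compactin (product_topology (\<lambda>_. euclidean) UNIV) (PiE UNIV (\<lambda>_::nat. {..<k}))"
    by (subst compactin_PiE) (auto simp: finite_imp_compact)
  ultimately show ?thesis by (simp add: euclidean_product_topology)
qed

lemma uniformly_continuous_agree:
  fixes g :: "(nat \<Rightarrow> nat) \<Rightarrow> real"
  assumes "continuous_on (seqs k) g" "e > 0"
  obtains p where "\<And>x y. x \<in> seqs k \<Longrightarrow> y \<in> seqs k \<Longrightarrow> agree p x y \<Longrightarrow> \<bar>g x - g y\<bar> < e"
proof -
  have "\<exists>n. \<forall>y\<in>seqs k. agree n x y \<longrightarrow> \<bar>g y - g x\<bar> < e / 2" if x: "x \<in> seqs k" for x
  proof -
    have "open {z. \<bar>z - g x\<bar> < e / 2}" by (intro open_Collect_less continuous_intros)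
    then obtain A where "open A" "x \<in> A" "\<forall>y\<in>seqs k. y \<in> A \<longrightarrow> \<bar>g y - g x\<bar> < e / 2"
      using assms(1)[unfolded continuous_on_topological, rule_format, OF x, of "{z. \<bar>z - g x\<bar> < e / 2}"]
        assms(2) by auto
    thus ?thesis using open_contains_cylinder[of A x] by metis
  qed
  then obtain n where n:
    "\<And>x y. x \<in> seqs k \<Longrightarrow> y \<in> seqs k \<Longrightarrow> agree (n x) x y \<Longrightarrow> \<bar>g y - g x\<bar> < e / 2"
    by metis
  have cover: "seqs k \<subseteq> (\<Union>x\<in>seqs k. {y. agree (n x) x y})" by (auto simp: agree_def)
  obtain D where D: "D \<subseteq> seqs k" "finite D" "seqs k \<subseteq> (\<Union>x\<in>D. {y. agree (n x) x y})"
    by (rule compactE_image[OF compact_seqs[of k] _ cover]) (rule open_cylinder)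
  have "\<exists>p. \<forall>m\<in>n ` D. m \<le> p" using D(2) by (simp only: finite_nat_set_iff_bounded_le[symmetric] finite_imageI)
  then obtain p where p: "\<And>x. x \<in> D \<Longrightarrow> n x \<le> p" by blast
  have "\<bar>g x - g y\<bar> < e" if xy: "x \<in> seqs k" "y \<in> seqs k" "agree p x y" for x y
  proof -
    obtain c where c: "c \<in> D" "agree (n c) c x" using D(3) xy(1) by blast
    have "agree (n c) c y" using agree_trans[OF c(2) agree_mono[OF xy(3) p[OF c(1)]]] .
    moreover have "c \<in> seqs k" using c(1) D(1) by blast
    ultimately have "\<bar>g x - g c\<bar> < e / 2" "\<bar>g y - g c\<bar> < e / 2" using n c(2) xy by blast+
    thus ?thesis by linarith
  qed
  thus ?thesis by (rule that)
qed

lemma continuous_on_agreeI: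
  fixes f :: "(nat \<Rightarrow> nat) \<Rightarrow> real"
  assumes "\<And>x e. x \<in> S \<Longrightarrow> e > 0 \<Longrightarrow> \<exists>n. \<forall>y\<in>S. agree n x y \<longrightarrow> \<bar>f y - f x\<bar> < e"
  shows "continuous_on S f"
  unfolding continuous_on_topological
proof safe
  fix x B assume x: "x \<in> S" and B: "open B" "f x \<in> B"
  from openE[OF B] obtain e where e: "e > 0" "ball (f x) e \<subseteq> B" by blast
  from assms[OF x e(1)] obtain n where "\<forall>y\<in>S. agree n x y \<longrightarrow> \<bar>f y - f x\<bar> < e" by blast
  thus "\<exists>A. open A \<and> x \<in> A \<and> (\<forall>y\<in>S. y \<in> A \<longrightarrow> f y \<in> B)"
    using open_cylinder[of n x] e(2)
    by (intro exI[of _ "{y. agree n x y}"]) (auto simp: agree_def ball_def dist_real_def abs_minus_commute subset_iff)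
qed

lemma bounded_on_seqs:
  fixes g :: "(nat \<Rightarrow> nat) \<Rightarrow> real"
  assumes "continuous_on (seqs k) g"
  obtains C where "C > 0" "\<And>x. x \<in> seqs k \<Longrightarrow> \<bar>g x\<bar> \<le> C"
proof -
  have "bounded (g ` seqs k)"
    by (intro compact_imp_bounded compact_continuous_image assms compact_seqs)
  thus ?thesis using that unfolding bounded_pos by auto
qed

lemma shift_seq_in_seqs: "x \<in> seqs k \<Longrightarrow> (shift_seq ^^ j) x \<in> seqs k"
  by (auto simp: seqs_def shift_seq_pow)

section \<open>The substitution on sequences\<close>

abbreviation letter_len :: "nat \<Rightarrow> nat \<Rightarrow> nat" where
  "letter_len k a \<equiv> length (subst_letter k a)"

lemma letter_len_eq: "letter_len k a = (if a = k - 1 then 1 else 2)"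
  by (simp add: subst_letter_def)

lemma length_subst_word_ge: "length w \<le> length (subst_word k w)"
  by (induction w) (auto simp: subst_word_def subst_letter_def)

lemma subst_word_append: "subst_word k (u @ w) = subst_word k u @ subst_word k w"
  by (simp add: subst_word_def)

lemma subst_seq_prefix:
  assumes "i < m"
  shows "subst_word k (map x [0..<m]) ! i = subst_seq k x i"
proof -
  have "[0..<m] = [0..<Suc i] @ [Suc i..<m]" using assms by (metis Suc_leI le0 upt_add_eq_append le_Suc_ex)
  hence "subst_word k (map x [0..<m]) =
      subst_word k (map x [0..<Suc i]) @ subst_word k (map x [Suc i..<m])"
    by (simp only: map_append subst_word_append)
  moreover have "i < length (subst_word k (map x [0..<Suc i]))"
    using length_subst_word_ge[of "map x [0..<Suc i]" k] by simp
  ultimately show ?thesis by (simp only: nth_append subst_seq_def if_True)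
qed

text \<open>Peeling off the image of the first letter turns the definition by words of growing length into
a recursion over sequences; all later facts about the substitution rest on it.\<close>

lemma subst_seq_rec:
  "subst_seq k x i = (if i < letter_len k (x 0) then subst_letter k (x 0) ! i
     else subst_seq k (shift_seq x) (i - letter_len k (x 0)))"
proof -
  have *: "subst_word k (map x [0..<Suc i]) =
      subst_letter k (x 0) @ subst_word k (map (shift_seq x) [0..<i])"
    by (simp add: subst_word_def upt_conv_Cons map_Suc_upt[symmetric] shift_seq_def comp_def del: upt_Suc)
  have "subst_word k (map (shift_seq x) [0..<i]) ! (i - letter_len k (x 0))
      = subst_seq k (shift_seq x) (i - letter_len k (x 0))" if "\<not> i < letter_len k (x 0)"
    by (rule subst_seq_prefix) (use that in \<open>auto simp: letter_len_eq split: if_splits\<close>)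
  thus ?thesis unfolding subst_seq_def[of k x] * by (simp add: nth_append)
qed

lemma subst_seq_0 [simp]: "subst_seq k x 0 = 0"
  by (subst subst_seq_rec) (simp add: subst_letter_def)

lemma subst_seq_Suc_0: "subst_seq k x (Suc 0) = (if x 0 = k - 1 then 0 else Suc (x 0))"
  by (subst subst_seq_rec) (simp add: subst_letter_def)

text \<open>The position in \<open>s x\<close> at which the image of \<open>x t\<close> begins.\<close>

definition img_len :: "nat \<Rightarrow> (nat \<Rightarrow> nat) \<Rightarrow> nat \<Rightarrow> nat" where
  "img_len k x t = (\<Sum>u<t. letter_len k (x u))"

lemma img_len_0 [simp]: "img_len k x 0 = 0"
  by (simp add: img_len_def)

lemma img_len_Suc: "img_len k x (Suc t) = img_len k x t + letter_len k (x t)"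
  by (simp add: img_len_def)

lemma img_len_Suc_shift: "img_len k x (Suc t) = letter_len k (x 0) + img_len k (shift_seq x) t"
  unfolding img_len_def shift_seq_def by (rule sum.lessThan_Suc_shift)

lemma img_len_add: "img_len k x (t + u) = img_len k x t + img_len k ((shift_seq ^^ t) x) u"
  by (induction u) (auto simp: img_len_Suc shift_seq_pow)

lemma img_len_ge: "t \<le> img_len k x t"
  by (induction t) (auto simp: img_len_Suc letter_len_eq)

lemma img_len_mono: "t \<le> u \<Longrightarrow> img_len k x t \<le> img_len k x u"
  by (auto simp: img_len_def intro!: sum_mono2)

lemma img_len_agree: "agree t x y \<Longrightarrow> img_len k x t = img_len k y t"
  by (auto simp: img_len_def agree_def intro!: sum.cong)

text \<open>The conjugacy \<open>\<sigma>\<^sup>N \<circ> s = s \<circ> \<sigma>\<^sup>t\<close>, where \<open>N\<close> is the length of the image of the first \<open>t\<close> letters.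
It makes every point of an orbit of \<open>s x\<close> a shift, by at most one, of the image of a point of the orbit
of \<open>x\<close>.\<close>

lemma shift_subst_seq:
  "(shift_seq ^^ img_len k x t) (subst_seq k x) = subst_seq k ((shift_seq ^^ t) x)"
proof (induction t arbitrary: x)
  case 0
  show ?case by simp
next
  case (Suc t)
  have first: "(shift_seq ^^ letter_len k (x 0)) (subst_seq k x) = subst_seq k (shift_seq x)"
    using subst_seq_rec[of k x] by (simp add: shift_seq_pow fun_eq_iff)
  have "(shift_seq ^^ img_len k x (Suc t)) (subst_seq k x) =
      (shift_seq ^^ img_len k (shift_seq x) t) (subst_seq k (shift_seq x))"
    by (simp only: img_len_Suc_shift shift_seq_pow_add first)
  also have "\<dots> = subst_seq k ((shift_seq ^^ t) (shift_seq x))" by (rule Suc.IH)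
  finally show ?case by (simp only: funpow_Suc_right comp_def)
qed

lemma subst_seq_img_len_add:
  "subst_seq k x (img_len k x t + i) = subst_seq k ((shift_seq ^^ t) x) i"
  using fun_cong[OF shift_subst_seq[of k x t], of i] by (simp add: shift_seq_pow)

lemma position_in_image:
  obtains t e where "n = img_len k x t + e" "e < letter_len k (x t)" "t \<le> n"
proof -
  have "\<exists>t e. n = img_len k x t + e \<and> e < letter_len k (x t)"
  proof (induction n)
    case 0
    show ?case by (rule exI[of _ 0]) (auto simp: letter_len_eq)
  next
    case (Suc n)
    then obtain t e where te: "n = img_len k x t + e" "e < letter_len k (x t)" by blast
    show ?case
    proof (cases "Suc e < letter_len k (x t)")
      case True
      thus ?thesis using te by (metis add_Suc_right)
    next
      case False
      hence "Suc n = img_len k x (Suc t) + 0" using te by (simp add: img_len_Suc)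
      moreover have "0 < letter_len k (x (Suc t))" by (simp add: letter_len_eq)
      ultimately show ?thesis by blast
    qed
  qed
  then obtain t e where "n = img_len k x t + e" "e < letter_len k (x t)" by blast
  moreover have "t \<le> n" using img_len_ge[of t k x] calculation by simp
  ultimately show ?thesis by (rule that)
qed

lemma position_letter_cases:
  assumes "e < letter_len k a"
  shows "e = 0 \<or> e = 1 \<and> a \<noteq> k - 1"
  using assms by (auto simp: letter_len_eq split: if_splits)

lemma subst_seq_in_seqs:
  assumes "x \<in> seqs k"
  shows "subst_seq k x \<in> seqs k"
  unfolding seqs_def
proof safe
  fix n
  obtain t e where te: "n = img_len k x t + e" "e < letter_len k (x t)"
    using position_in_image by blast
  have "x t < k" using assms by (simp add: seqs_def)
  thus "subst_seq k x n < k"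
    using position_letter_cases[OF te(2)] unfolding te(1) subst_seq_img_len_add
    by (auto simp: subst_seq_Suc_0 shift_seq_pow)
qed

lemma subst_pow_in_seqs: "x \<in> seqs k \<Longrightarrow> (subst_seq k ^^ n) x \<in> seqs k"
  by (induction n) (auto simp: subst_seq_in_seqs)

text \<open>The gain of one letter comes from the \<open>0\<close> with which every image begins.\<close>

lemma agree_subst_seq:
  assumes "agree t x y"
  shows "agree (Suc (img_len k x t)) (subst_seq k x) (subst_seq k y)"
  using assms
proof (induction t arbitrary: x y)
  case 0
  show ?case by (simp add: agree_def)
next
  case (Suc t)
  have 0: "x 0 = y 0" using Suc.prems by (auto simp: agree_def)
  have "agree t (shift_seq x) (shift_seq y)" using Suc.prems by (auto simp: agree_def shift_seq_def)
  note IH = Suc.IH[OF this]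
  show ?case
    unfolding agree_def
  proof safe
    fix i assume "i < Suc (img_len k x (Suc t))"
    thus "subst_seq k x i = subst_seq k y i"
      using IH 0 subst_seq_rec[of k x i] subst_seq_rec[of k y i]
      by (auto simp: img_len_Suc_shift agree_def)
  qed
qed

text \<open>A letter \<open>a\<close> can be read off from the letter after the \<open>0\<close> that begins its image: this is
\<open>a + 1\<close>, or, if \<open>a = k - 1\<close>, the \<open>0\<close> that begins the next image. Two letters beyond the image of
the first \<open>m\<close> letters thus determine the letter number \<open>m\<close>.\<close>

lemma agree_subst_seqD:
  assumes "agree (img_len k x m + 2) (subst_seq k x) (subst_seq k y)"
  shows "agree (Suc m) x y"
  using assms
proof (induction m arbitrary: x y)
  case 0
  have "subst_seq k x (Suc 0) = subst_seq k y (Suc 0)" using 0 by (auto simp: agree_def)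
  hence "x 0 = y 0" by (simp add: subst_seq_Suc_0 split: if_splits)
  thus ?case by (simp add: agree_def)
next
  case (Suc m)
  have "subst_seq k x (Suc 0) = subst_seq k y (Suc 0)" using Suc.prems by (auto simp: agree_def)
  hence 0: "x 0 = y 0" by (simp add: subst_seq_Suc_0 split: if_splits)
  have "agree (img_len k (shift_seq x) m + 2) (subst_seq k (shift_seq x)) (subst_seq k (shift_seq y))"
    unfolding agree_def
  proof safe
    fix i assume i: "i < img_len k (shift_seq x) m + 2"
    have "subst_seq k x (letter_len k (x 0) + i) = subst_seq k y (letter_len k (x 0) + i)"
      using Suc.prems i by (auto simp: agree_def img_len_Suc_shift)
    thus "subst_seq k (shift_seq x) i = subst_seq k (shift_seq y) i"
      using 0 subst_seq_rec[of k x "letter_len k (x 0) + i"]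
        subst_seq_rec[of k y "letter_len k (x 0) + i"] by simp
  qed
  from Suc.IH[OF this] 0 show ?case
    by (auto simp: agree_def shift_seq_def less_Suc_eq_0_disj)
qed

section \<open>Birkhoff sums and iterates of the renormalization operator\<close>

definition birkhoff :: "((nat \<Rightarrow> nat) \<Rightarrow> real) \<Rightarrow> nat \<Rightarrow> (nat \<Rightarrow> nat) \<Rightarrow> real" where
  "birkhoff f n x = (\<Sum>j<n. f ((shift_seq ^^ j) x))"

lemma birkhoff_0 [simp]: "birkhoff f 0 x = 0"
  by (simp add: birkhoff_def)

lemma birkhoff_Suc: "birkhoff f (Suc n) x = birkhoff f n x + f ((shift_seq ^^ n) x)"
  by (simp add: birkhoff_def)

lemma birkhoff_1 [simp]: "birkhoff f (Suc 0) x = f x"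
  by (simp add: birkhoff_def)

lemma birkhoff_add: "birkhoff f (m + n) x = birkhoff f m x + birkhoff f n ((shift_seq ^^ m) x)"
  by (induction n) (simp_all add: birkhoff_Suc shift_seq_pow_add[symmetric])

lemma birkhoff_diff: "birkhoff (\<lambda>x. f x - c * g x) n x = birkhoff f n x - c * birkhoff g n x"
  by (simp add: birkhoff_def sum_subtractf sum_distrib_left)

lemma birkhoff_const [simp]: "birkhoff (\<lambda>_. c) n x = real n * c"
  by (simp add: birkhoff_def)

lemma birkhoff_cong:
  assumes "x \<in> seqs k" "\<And>y. y \<in> seqs k \<Longrightarrow> f y = g y"
  shows "birkhoff f n x = birkhoff g n x"
  unfolding birkhoff_def by (intro sum.cong refl assms shift_seq_in_seqs)

lemma abs_birkhoff_le:
  assumes "x \<in> seqs k" "\<And>y. y \<in> seqs k \<Longrightarrow> \<bar>f y\<bar> \<le> g y"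
  shows "\<bar>birkhoff f n x\<bar> \<le> birkhoff g n x"
  unfolding birkhoff_def
  by (rule order.trans[OF sum_abs sum_mono]) (intro assms shift_seq_in_seqs)

text \<open>The position in \<open>s\<^sup>n x\<close> at which the \<open>s\<^sup>n\<close>-image of \<open>x t\<close> begins. For \<open>t = 1\<close> it is the
length of the \<open>s\<^sup>n\<close>-image of the first letter, the number of terms of \<open>R\<^sup>n V x\<close>.\<close>

primrec iter_len :: "nat \<Rightarrow> nat \<Rightarrow> (nat \<Rightarrow> nat) \<Rightarrow> nat \<Rightarrow> nat" where
  "iter_len k 0 x t = t"
| "iter_len k (Suc n) x t = img_len k ((subst_seq k ^^ n) x) (iter_len k n x t)"

lemma iter_len_Suc_inner: "iter_len k (Suc n) x t = iter_len k n (subst_seq k x) (img_len k x t)"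
proof (induction n)
  case (Suc n)
  have "iter_len k (Suc (Suc n)) x t = img_len k ((subst_seq k ^^ Suc n) x) (iter_len k (Suc n) x t)"
    by (simp only: iter_len.simps)
  also have "\<dots> = img_len k ((subst_seq k ^^ n) (subst_seq k x))
      (iter_len k n (subst_seq k x) (img_len k x t))"
    by (simp only: Suc.IH) (simp only: funpow_Suc_right comp_def)
  finally show ?case by (simp only: iter_len.simps)
qed simp

lemma shift_subst_pow:
  "(shift_seq ^^ iter_len k n x t) ((subst_seq k ^^ n) x) = (subst_seq k ^^ n) ((shift_seq ^^ t) x)"
  by (induction n) (simp_all add: shift_subst_seq)

lemma iter_len_add:
  "iter_len k n x (t + u) = iter_len k n x t + iter_len k n ((shift_seq ^^ t) x) u"
  by (induction n) (simp_all add: img_len_add shift_subst_pow)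

lemma iter_len_ge: "t \<le> iter_len k n x t"
  by (induction n) (auto intro: order.trans[OF _ img_len_ge])

lemma iter_len_0 [simp]: "iter_len k n x 0 = 0"
  by (induction n) auto

lemma agree_subst_pow:
  assumes "agree t x y"
  shows "iter_len k n x t = iter_len k n y t \<and>
    agree (iter_len k n x t) ((subst_seq k ^^ n) x) ((subst_seq k ^^ n) y)"
proof (induction n)
  case (Suc n)
  let ?t = "iter_len k n x t" and ?x = "(subst_seq k ^^ n) x" and ?y = "(subst_seq k ^^ n) y"
  have t: "iter_len k n y t = ?t" and ag: "agree ?t ?x ?y" using Suc by auto
  have "agree (img_len k ?x ?t) (subst_seq k ?x) (subst_seq k ?y)"
    by (rule agree_mono[OF agree_subst_seq[OF ag]]) simp
  thus ?case using img_len_agree[OF ag] by (simp add: t)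
qed (use assms in simp)

lemma position_in_iterate:
  obtains t e where "n = iter_len k q x t + e" "e < iter_len k q ((shift_seq ^^ t) x) 1"
proof -
  have "\<exists>t e. n = iter_len k q x t + e \<and> e < iter_len k q ((shift_seq ^^ t) x) 1"
  proof (induction n)
    case 0
    have "0 < iter_len k q x 1" using iter_len_ge[of 1 k q x] by simp
    thus ?case by (intro exI[of _ 0]) simp
  next
    case (Suc n)
    then obtain t e where te: "n = iter_len k q x t + e" "e < iter_len k q ((shift_seq ^^ t) x) 1"
      by blast
    show ?case
    proof (cases "Suc e < iter_len k q ((shift_seq ^^ t) x) 1")
      case True
      thus ?thesis using te by (metis add_Suc_right)
    next
      case False
      hence "Suc n = iter_len k q x (t + 1) + 0" using te by (simp only: iter_len_add)
      moreover have "0 < iter_len k q ((shift_seq ^^ (t + 1)) x) 1"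
        using iter_len_ge[of 1 k q "(shift_seq ^^ (t + 1)) x"] by simp
      ultimately show ?thesis by blast
    qed
  qed
  then obtain t e where "n = iter_len k q x t + e" "e < iter_len k q ((shift_seq ^^ t) x) 1"
    by blast
  thus ?thesis by (rule that)
qed

lemma renorm_eq_birkhoff: "renorm k V x = birkhoff V (letter_len k (x 0)) (subst_seq k x)"
  by (simp add: renorm_def birkhoff_def)

lemma renorm_eq:
  "renorm k V x = V (subst_seq k x) +
     (if x 0 = k - 1 then 0 else V (shift_seq (subst_seq k x)))"
  by (simp add: renorm_def letter_len_eq numeral_2_eq_2)

text \<open>The terms of \<open>renorm k V (\<sigma>\<^sup>u x)\<close> are the values of \<open>V\<close> along the image of the letter \<open>x u\<close>
inside \<open>s x\<close>, so consecutive values of \<open>u\<close> concatenate their sums.\<close>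

lemma birkhoff_renorm: "birkhoff (renorm k V) t x = birkhoff V (img_len k x t) (subst_seq k x)"
proof (induction t)
  case (Suc t)
  show ?case
    unfolding birkhoff_Suc Suc.IH img_len_Suc birkhoff_add shift_subst_seq
    by (simp add: renorm_eq_birkhoff shift_seq_pow)
qed simp

lemma birkhoff_renorm_pow:
  "birkhoff ((renorm k ^^ n) V) t x = birkhoff V (iter_len k n x t) ((subst_seq k ^^ n) x)"
proof (induction n arbitrary: t x)
  case (Suc n)
  have "birkhoff ((renorm k ^^ Suc n) V) t x
      = birkhoff ((renorm k ^^ n) V) (img_len k x t) (subst_seq k x)"
    by (simp add: birkhoff_renorm)
  also have "\<dots> = birkhoff V (iter_len k n (subst_seq k x) (img_len k x t))
      ((subst_seq k ^^ n) (subst_seq k x))" by (rule Suc.IH)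
  finally show ?case by (simp only: iter_len_Suc_inner funpow_Suc_right comp_def)
qed simp

lemma renorm_pow_eq_birkhoff:
  "(renorm k ^^ n) V x = birkhoff V (iter_len k n x 1) ((subst_seq k ^^ n) x)"
  using birkhoff_renorm_pow[of n k V 1 x] by simp

section \<open>The fixed point of the substitution and its language\<close>

locale kbonacci =
  fixes k :: nat
  assumes k_ge_2: "k \<ge> 2"
begin

abbreviation iter_word :: "nat \<Rightarrow> nat list" where
  "iter_word m \<equiv> (subst_word k ^^ m) [0]"

lemma subst_word_pow_append:
  "(subst_word k ^^ m) (u @ w) = (subst_word k ^^ m) u @ (subst_word k ^^ m) w"
  by (induction m) (simp_all add: subst_word_append)

lemma length_subst_word_pow_ge: "length w \<le> length ((subst_word k ^^ m) w)"
  by (induction m) (auto intro: order.trans[OF _ length_subst_word_ge])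

text \<open>The word \<open>s\<^sup>m(0)\<close> is a proper prefix of the next one because \<open>s(0) = 01\<close>, which uses \<open>k \<ge> 2\<close>.\<close>

lemma iter_word_Suc: "iter_word (Suc m) = iter_word m @ (subst_word k ^^ m) [1]"
proof -
  have "subst_word k [0] = [0] @ [1]"
    using k_ge_2 by (simp add: subst_word_def subst_letter_def)
  hence "iter_word (Suc m) = (subst_word k ^^ m) ([0] @ [1])"
    by (simp only: funpow_Suc_right comp_def)
  thus ?thesis by (simp only: subst_word_pow_append)
qed

lemma length_iter_word: "m < length (iter_word m)"
proof (induction m)
  case (Suc m)
  have "length [1::nat] \<le> length ((subst_word k ^^ m) [1])" by (rule length_subst_word_pow_ge)
  thus ?case using Suc unfolding iter_word_Suc by simp
qed simp

lemma iter_word_nth_stable: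
  assumes "i < length (iter_word m)" "m \<le> m'"
  shows "i < length (iter_word m') \<and> iter_word m' ! i = iter_word m ! i"
  using assms(2)
proof (induction rule: dec_induct)
  case (step n)
  thus ?case unfolding iter_word_Suc by (simp add: nth_append)
qed (use assms in simp)

lemma omega_nth:
  assumes "i < length (iter_word m)"
  shows "omega k i = iter_word m ! i"
proof -
  have "(\<lambda>n. iter_word n ! i) \<longlonglongrightarrow> iter_word m ! i"
    by (rule tendsto_eventually, rule eventually_sequentiallyI[of m])
       (use iter_word_nth_stable[OF assms] in blast)
  thus ?thesis unfolding omega_def by (rule limI)
qed

lemma subst_seq_omega: "subst_seq k (omega k) = omega k"
proof
  fix n
  let ?W = "iter_word n"
  have "map (omega k) [0..<length ?W] = ?W" by (rule nth_equalityI) (simp_all add: omega_nth)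
  hence "subst_seq k (omega k) n = iter_word (Suc n) ! n"
    using subst_seq_prefix[OF length_iter_word[of n], of k "omega k"] by simp
  also have "\<dots> = omega k n" using length_iter_word[of "Suc n"] by (intro omega_nth[symmetric]) simp
  finally show "subst_seq k (omega k) n = omega k n" .
qed

lemma subst_pow_omega: "(subst_seq k ^^ n) (omega k) = omega k"
  by (induction n) (simp_all add: subst_seq_omega)

lemma omega_0: "omega k 0 = 0"
  using subst_seq_0[of k "omega k"] by (simp add: subst_seq_omega)

lemma omega_block:
  "omega k (img_len k (omega k) t + i) = subst_seq k ((shift_seq ^^ t) (omega k)) i"
  using subst_seq_img_len_add[of k "omega k" t i] by (simp add: subst_seq_omega)

lemma omega_in_seqs: "omega k \<in> seqs k"
proof -
  have "omega k n < k" for n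
  proof (induction n rule: less_induct)
    case (less n)
    obtain t e where te: "n = img_len k (omega k) t + e" "e < letter_len k (omega k t)" "t \<le> n"
      using position_in_image[of n k "omega k"] by blast
    show ?case
    proof (cases "e = 0")
      case True
      thus ?thesis using k_ge_2 unfolding te(1) omega_block by simp
    next
      case False
      hence e: "e = 1" "omega k t \<noteq> k - 1" using position_letter_cases[OF te(2)] by auto
      hence "t < n" using te(1) img_len_ge[of t k "omega k"] by simp
      hence "omega k t < k" by (rule less)
      thus ?thesis using e unfolding te(1) omega_block by (simp add: subst_seq_Suc_0 shift_seq_pow)
    qed
  qed
  thus ?thesis by (simp add: seqs_def)
qed

lemma letter_in_omega: "a < k \<Longrightarrow> \<exists>t. omega k t = a"
proof (induction a)
  case 0
  show ?case using omega_0 by blast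
next
  case (Suc a)
  then obtain t where t: "omega k t = a" by auto
  have "omega k (img_len k (omega k) t + 1) = Suc a"
    using t Suc.prems unfolding omega_block by (simp add: subst_seq_Suc_0 shift_seq_pow)
  thus ?case by blast
qed

text \<open>The language of the subshift, stated for prefixes of sequences instead of words: this makes the distance to the subshift, and hence \<open>delta\<close>, directly expressible.\<close>

definition legal :: "nat \<Rightarrow> (nat \<Rightarrow> nat) \<Rightarrow> bool" where
  "legal n x \<longleftrightarrow> (\<exists>M. agree n x ((shift_seq ^^ M) (omega k)))"

lemma legal_mono: "legal n x \<Longrightarrow> m \<le> n \<Longrightarrow> legal m x"
  unfolding legal_def using agree_mono by blast

lemma legal_agree: "legal n x \<Longrightarrow> agree n x y \<Longrightarrow> legal n y"
  unfolding legal_def using agree_trans agree_sym by blast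

lemma legal_shift: "legal n x \<Longrightarrow> legal (n - j) ((shift_seq ^^ j) x)"
proof -
  assume "legal n x"
  then obtain M where "agree n x ((shift_seq ^^ M) (omega k))" by (auto simp: legal_def)
  from agree_shift[OF this, of j] show ?thesis
    unfolding legal_def shift_seq_pow_add[symmetric] by blast
qed

lemma legal_1:
  assumes "x \<in> seqs k"
  shows "legal 1 x"
proof -
  obtain M where "omega k M = x 0" using letter_in_omega[of "x 0"] assms by (auto simp: seqs_def)
  hence "agree 1 x ((shift_seq ^^ M) (omega k))" by (simp add: agree_def shift_seq_pow)
  thus ?thesis unfolding legal_def by blast
qed

lemma subst_space_iff: "x \<in> subst_space k \<longleftrightarrow> (\<forall>n. legal n x)"
  unfolding subst_space_def closure_iff_agree legal_def by auto

lemma subst_space_subset: "subst_space k \<subseteq> seqs k"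
proof
  fix x assume "x \<in> subst_space k"
  hence "legal (Suc n) x" for n by (simp add: subst_space_iff)
  hence "\<exists>M. x n = omega k (M + n)" for n by (auto simp: legal_def agree_def shift_seq_pow)
  moreover have "omega k i < k" for i using omega_in_seqs by (simp add: seqs_def)
  ultimately have "x n < k" for n by (metis (no_types))
  thus "x \<in> seqs k" by (simp add: seqs_def)
qed

text \<open>Since \<open>\<omega> = s \<omega>\<close>, an occurrence of a word in \<open>\<omega>\<close> yields one of its image, followed by the \<open>0\<close>
that begins the next block.\<close>

lemma legal_subst:
  assumes "legal m x"
  shows "legal (Suc (img_len k x m)) (subst_seq k x)"
proof -
  obtain M where "agree m x ((shift_seq ^^ M) (omega k))" using assms by (auto simp: legal_def)
  from agree_subst_seq[OF this, of k] show ?thesis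
    unfolding legal_def shift_subst_seq[symmetric] subst_seq_omega by blast
qed

text \<open>Recognizability. In \<open>\<omega> = s \<omega>\<close> the blocks begin exactly at the letters \<open>0\<close>, and a letter \<open>a + 1\<close>
is always the second letter of the block of \<open>a\<close>. An occurrence in \<open>\<omega>\<close> of a prefix of \<open>s x\<close>, possibly
cut inside the image of the first letter, is therefore aligned with the blocks and extends to the left
to full blocks, which can be decoded.\<close>

lemma legal_substD:
  assumes "legal (img_len k x m + 2 - j) ((shift_seq ^^ j) (subst_seq k x))"
    "j < letter_len k (x 0)"
  shows "legal (Suc m) x"
proof -
  let ?\<omega> = "omega k"
  obtain M where M: "agree (img_len k x m + 2 - j) ((shift_seq ^^ j) (subst_seq k x))
      ((shift_seq ^^ M) ?\<omega>)"
    using assms(1) by (auto simp: legal_def)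
  obtain t e where te: "M = img_len k ?\<omega> t + e" "e < letter_len k (?\<omega> t)"
    using position_in_image by blast
  have first: "subst_seq k x j = ?\<omega> M"
  proof -
    have "0 < img_len k x m + 2 - j" using position_letter_cases[OF assms(2)] by auto
    thus ?thesis using M unfolding agree_def by (force simp: shift_seq_pow)
  qed
  have \<omega>M: "?\<omega> M = subst_seq k ((shift_seq ^^ t) ?\<omega>) e" unfolding te(1) omega_block ..
  have \<omega>M': "?\<omega> M = (if e = 0 then 0 else Suc (?\<omega> t))"
    using position_letter_cases[OF te(2)] unfolding \<omega>M by (auto simp: subst_seq_Suc_0 shift_seq_pow)
  have xj: "subst_seq k x j = (if j = 0 then 0 else Suc (x 0))"
    using position_letter_cases[OF assms(2)] by (auto simp: subst_seq_Suc_0)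
  (* a letter 0 begins a block and a nonzero letter does not, so both cuts are at the same place *)
  have "j = e"
    using first \<omega>M' xj position_letter_cases[OF te(2)] position_letter_cases[OF assms(2)]
    by (auto split: if_splits)
  have "agree (img_len k x m + 2) (subst_seq k x) (subst_seq k ((shift_seq ^^ t) ?\<omega>))"
    unfolding agree_def
  proof safe
    fix i assume i: "i < img_len k x m + 2"
    show "subst_seq k x i = subst_seq k ((shift_seq ^^ t) ?\<omega>) i"
    proof (cases "i < j")
      case True
      hence "i = 0" using position_letter_cases[OF assms(2)] by auto
      thus ?thesis by simp
    next
      case False
      then obtain d where d: "i = j + d" using le_Suc_ex not_less by blast
      have "subst_seq k x (j + d) = ?\<omega> (M + d)"
        using M i d unfolding agree_def shift_seq_pow by auto
      also have "\<dots> = subst_seq k ((shift_seq ^^ t) ?\<omega>) (j + d)"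
        unfolding te(1) \<open>j = e\<close> add.assoc by (rule omega_block)
      finally show ?thesis by (simp add: d)
    qed
  qed
  from agree_subst_seqD[OF this] show ?thesis unfolding legal_def by blast
qed

text \<open>By \<open>delta_exits_at\<close>, this says that \<open>delta k x = m\<close>.\<close>

definition exits_at :: "nat \<Rightarrow> (nat \<Rightarrow> nat) \<Rightarrow> bool" where
  "exits_at m x \<longleftrightarrow> legal m x \<and> \<not> legal (Suc m) x"

lemma exits_at_not_in_space: "exits_at m x \<Longrightarrow> x \<notin> subst_space k"
  by (auto simp: exits_at_def subst_space_iff)

lemma exits_at_exists:
  assumes "x \<notin> subst_space k"
  obtains m where "exits_at m x"
proof -
  obtain n where n: "\<not> legal n x" using assms by (auto simp: subst_space_iff)
  have "legal 0 x" by (simp add: legal_def agree_def)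
  have "\<exists>m. legal m x \<and> \<not> legal (Suc m) x"
  proof (rule ccontr)
    assume "\<nexists>m. legal m x \<and> \<not> legal (Suc m) x"
    hence "legal m x" for m using \<open>legal 0 x\<close> by (induction m) auto
    thus False using n by blast
  qed
  thus ?thesis using that by (auto simp: exits_at_def)
qed

lemma exits_at_pos: "x \<in> seqs k \<Longrightarrow> exits_at m x \<Longrightarrow> 1 \<le> m"
  using legal_1[of x] by (cases m) (auto simp: exits_at_def)

text \<open>Cutting off the first letter of a two-letter image does not postpone the exit, since that letter is
recovered from the next one.\<close>

lemma exits_at_subst:
  assumes "exits_at m x" "j < letter_len k (x 0)"
  shows "exits_at (img_len k x m + 1 - j) ((shift_seq ^^ j) (subst_seq k x))"
proof -
  have "j \<le> 1" using position_letter_cases[OF assms(2)] by auto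
  have "legal (Suc (img_len k x m) - j) ((shift_seq ^^ j) (subst_seq k x))"
    using assms by (intro legal_shift legal_subst) (simp add: exits_at_def)
  moreover have "\<not> legal (img_len k x m + 2 - j) ((shift_seq ^^ j) (subst_seq k x))"
    using legal_substD[of x m j] assms unfolding exits_at_def by blast
  moreover have "Suc (Suc (img_len k x m) - j) = img_len k x m + 2 - j" using \<open>j \<le> 1\<close> by simp
  ultimately show ?thesis unfolding exits_at_def by simp
qed

text \<open>A point of the subshift agrees with \<open>x\<close> on a legal prefix only, hence on at most \<open>m\<close> letters;
a shift of \<open>\<omega>\<close> attains this bound.\<close>

lemma delta_exits_at:
  assumes "exits_at m x"
  shows "delta k x = enat m"
proof -
  have notin: "x \<notin> subst_space k" using assms by (rule exits_at_not_in_space)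
  obtain M where M: "agree m x ((shift_seq ^^ M) (omega k))"
    using assms by (auto simp: exits_at_def legal_def)
  define y where "y = (shift_seq ^^ M) (omega k)"
  have y: "y \<in> subst_space k" unfolding subst_space_iff y_def legal_def by (auto simp: agree_def)
  have lower: "(1/2) ^ m \<le> word_dist x z" if z: "z \<in> subst_space k" for z
  proof -
    have "x \<noteq> z" using notin z by blast
    define n where "n = (LEAST n. x n \<noteq> z n)"
    have "agree n x z" unfolding agree_def n_def using not_less_Least by blast
    hence "legal n x" using z agree_sym legal_agree unfolding subst_space_iff by blast
    hence "n \<le> m" using assms legal_mono[of n x "Suc m"] unfolding exits_at_def by (meson not_less_eq_eq)
    thus ?thesis using \<open>x \<noteq> z\<close> unfolding word_dist_def n_def[symmetric]
      by (simp add: power_decreasing)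
  qed
  have "word_dist x y \<le> (1/2) ^ m"
  proof (cases "x = y")
    case False
    then obtain i where "x i \<noteq> y i" by blast
    hence "x (LEAST n. x n \<noteq> y n) \<noteq> y (LEAST n. x n \<noteq> y n)" by (rule LeastI)
    hence "m \<le> (LEAST n. x n \<noteq> y n)" using M unfolding agree_def y_def[symmetric] by (meson not_less)
    thus ?thesis using False by (simp add: word_dist_def power_decreasing)
  qed (simp add: word_dist_def)
  hence "(INF z\<in>subst_space k. word_dist x z) = (1/2) ^ m"
    using y lower
    by (intro antisym cINF_greatest cINF_lower2[where x = y] bdd_belowI2[where m = "(1/2)^m"]) auto
  hence "(THE n. (INF z\<in>subst_space k. word_dist x z) = (1/2) ^ n) = m"
    by (auto intro!: the_equality simp: power_inject_exp')
  thus ?thesis using notin by (simp add: delta_def)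
qed

lemma delta_in_space: "x \<in> subst_space k \<Longrightarrow> delta k x = \<infinity>"
  by (simp add: delta_def)

lemma subst_space_subst:
  assumes "x \<in> subst_space k"
  shows "subst_seq k x \<in> subst_space k"
  unfolding subst_space_iff
proof
  fix n
  have "legal (Suc (img_len k x n)) (subst_seq k x)"
    using assms legal_subst by (simp add: subst_space_iff)
  thus "legal n (subst_seq k x)" by (rule legal_mono) (use img_len_ge[of n k x] in simp)
qed

lemma subst_space_shift:
  assumes "x \<in> subst_space k"
  shows "(shift_seq ^^ j) x \<in> subst_space k"
  unfolding subst_space_iff
proof
  fix n
  show "legal n ((shift_seq ^^ j) x)"
    using legal_shift[of "n + j" x j] assms by (simp add: subst_space_iff)
qed

text \<open>The value of \<open>delta\<close> at \<open>s\<^sup>n x\<close> when it is \<open>m\<close> at \<open>x\<close>: the longest legal prefix \<open>w\<close> of a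
sequence becomes \<open>s(w)0\<close>.\<close>

primrec exit_iter :: "(nat \<Rightarrow> nat) \<Rightarrow> nat \<Rightarrow> nat \<Rightarrow> nat" where
  "exit_iter x m 0 = m"
| "exit_iter x m (Suc n) = Suc (img_len k ((subst_seq k ^^ n) x) (exit_iter x m n))"

text \<open>Each point \<open>\<sigma>\<^sup>j(s\<^sup>n\<^sup>+\<^sup>1 x)\<close> of the block is \<open>\<sigma>\<^sup>e(s(\<sigma>\<^sup>i(s\<^sup>n x)))\<close> with \<open>e \<le> 1\<close>, so the one-step
statement propagates: along the whole first block the distance to the exit decreases by one at each
shift. This turns \<open>R\<^sup>n V x\<close> into a sum over an arithmetic progression of exit times.\<close>

lemma exits_at_iterate:
  assumes "x \<in> seqs k" "exits_at m x"
  shows "iter_len k n x 1 \<le> exit_iter x m n \<and>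
    (\<forall>j<iter_len k n x 1. exits_at (exit_iter x m n - j) ((shift_seq ^^ j) ((subst_seq k ^^ n) x)))"
proof (induction n)
  case 0
  show ?case using assms exits_at_pos by auto
next
  case (Suc n)
  let ?y = "(subst_seq k ^^ n) x" and ?N = "iter_len k n x 1" and ?D = "exit_iter x m n"
  have step: "exits_at (Suc (img_len k ?y ?D) - j) ((shift_seq ^^ j) (subst_seq k ?y))"
    if j: "j < img_len k ?y ?N" for j
  proof -
    obtain i e where ie: "j = img_len k ?y i + e" "e < letter_len k (?y i)"
      using position_in_image by blast
    have "i < ?N" using j ie img_len_mono[of ?N i k ?y] by linarith
    hence ex: "exits_at (?D - i) ((shift_seq ^^ i) ?y)" and le: "i \<le> ?D" using Suc.IH by auto
    have "img_len k ?y ?D = img_len k ?y i + img_len k ((shift_seq ^^ i) ?y) (?D - i)"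
      using img_len_add[of k ?y i "?D - i"] le by simp
    hence "Suc (img_len k ?y ?D) - j = img_len k ((shift_seq ^^ i) ?y) (?D - i) + 1 - e"
      using ie(1) by simp
    moreover have "(shift_seq ^^ j) (subst_seq k ?y) =
        (shift_seq ^^ e) (subst_seq k ((shift_seq ^^ i) ?y))"
      unfolding ie(1) shift_seq_pow_add shift_subst_seq ..
    moreover have "e < letter_len k (((shift_seq ^^ i) ?y) 0)" using ie(2) by (simp add: shift_seq_pow)
    ultimately show ?thesis using exits_at_subst[OF ex] by simp
  qed
  have "img_len k ?y ?N \<le> img_len k ?y ?D" using Suc.IH by (intro img_len_mono) blast
  thus ?case using step by auto
qed

end

section \<open>Letter weights and uniform averages\<close>

locale kbonacci_root = kbonacci +
  fixes \<beta> :: real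
  assumes beta_gt_1: "\<beta> > 1"
    and beta_root: "\<beta> ^ k = (\<Sum>j<k. \<beta> ^ j)"
begin

abbreviation weight :: "(nat \<Rightarrow> nat) \<Rightarrow> real" where
  "weight x \<equiv> letter_weight k \<beta> (x 0)"

lemma letter_weight_eq: "letter_weight k \<beta> l = (\<Sum>j\<le>k - 1 - l. (1 / \<beta>) ^ j)"
proof -
  define n where "n = k - 1 - l"
  have "(\<Sum>j\<le>n. (1 / \<beta>) ^ j) = (\<Sum>j\<le>n. (1 / \<beta>) ^ (n - j))"
    by (rule sum.reindex_bij_witness[of _ "\<lambda>j. n - j" "\<lambda>j. n - j"]) auto
  also have "\<dots> = (\<Sum>j\<le>n. \<beta> ^ j / \<beta> ^ n)"
    using beta_gt_1 by (intro sum.cong refl) (simp add: power_one_over power_diff)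
  also have "\<dots> = letter_weight k \<beta> l"
    by (simp add: letter_weight_def n_def sum_divide_distrib atMost_atLeast0)
  finally show ?thesis unfolding n_def by simp
qed

lemma letter_weight_last: "letter_weight k \<beta> (k - 1) = 1"
  by (simp add: letter_weight_eq)

text \<open>With the values at the two ends, this says that the weights form a left eigenvector of the
incidence matrix of the substitution: the weight of \<open>s(l)\<close> is \<open>\<beta>\<close> times that of \<open>l\<close>.\<close>

lemma letter_weight_Suc:
  assumes "l < k - 1"
  shows "letter_weight k \<beta> (Suc l) = \<beta> * (letter_weight k \<beta> l - 1)"
proof -
  have "k - 1 - l = Suc (k - 1 - Suc l)" using assms by simp
  hence "letter_weight k \<beta> l = (\<Sum>j\<le>Suc (k - 1 - Suc l). (1 / \<beta>) ^ j)"
    by (simp only: letter_weight_eq)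
  also have "\<dots> = 1 + letter_weight k \<beta> (Suc l) / \<beta>"
    unfolding sum.atMost_Suc_shift letter_weight_eq by (simp add: sum_divide_distrib field_simps)
  finally show ?thesis using beta_gt_1 by simp
qed

lemma letter_weight_0: "letter_weight k \<beta> 0 = \<beta>"
proof -
  have *: "{0..k - 1} = {..<k}" using k_ge_2 by auto
  have "letter_weight k \<beta> 0 = \<beta> ^ k / \<beta> ^ (k - 1)"
    unfolding letter_weight_def beta_root by (simp only: * diff_zero) simp
  also have "\<dots> = \<beta>" using beta_gt_1 k_ge_2 by (cases k) auto
  finally show ?thesis .
qed

lemma letter_weight_ge_1: "1 \<le> letter_weight k \<beta> l"
proof -
  have "(\<Sum>j\<in>{0}. (1 / \<beta>) ^ j) \<le> (\<Sum>j\<le>k - 1 - l. (1 / \<beta>) ^ j)"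
    using beta_gt_1 by (intro sum_mono2) auto
  thus ?thesis by (simp add: letter_weight_eq)
qed

lemma letter_weight_le: "letter_weight k \<beta> l \<le> \<beta>"
proof -
  have "letter_weight k \<beta> l \<le> letter_weight k \<beta> 0"
    unfolding letter_weight_eq using beta_gt_1 by (intro sum_mono2) auto
  thus ?thesis by (simp add: letter_weight_0)
qed

lemma letter_weight_pos: "0 < letter_weight k \<beta> l"
  using letter_weight_ge_1[of l] by simp

lemma weight_shift_subst:
  assumes "x \<in> seqs k" "x 0 \<noteq> k - 1"
  shows "weight (shift_seq (subst_seq k x)) = \<beta> * (weight x - 1)"
proof -
  have "x 0 < k" using assms(1) by (simp add: seqs_def)
  thus ?thesis using assms(2) letter_weight_Suc[of "x 0"]
    by (simp add: shift_seq_def subst_seq_Suc_0)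
qed

lemma shift_subst_in_seqs: "x \<in> seqs k \<Longrightarrow> shift_seq (subst_seq k x) \<in> seqs k"
  using shift_seq_in_seqs[of "subst_seq k x" k 1] subst_seq_in_seqs by simp

lemma renorm_weight:
  assumes "x \<in> seqs k"
  shows "renorm k weight x = \<beta> * weight x"
  using weight_shift_subst[OF assms] letter_weight_last
  by (simp add: renorm_eq letter_weight_0 algebra_simps)

lemma renorm_pow_weight:
  assumes "x \<in> seqs k"
  shows "(renorm k ^^ n) weight x = \<beta> ^ n * weight x"
  using assms
proof (induction n arbitrary: x)
  case (Suc n)
  have "(renorm k ^^ Suc n) weight x = renorm k (\<lambda>x. \<beta> ^ n * weight x) x"
    using Suc.IH[OF subst_seq_in_seqs[OF Suc.prems]] Suc.IH[OF shift_subst_in_seqs[OF Suc.prems]]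
    by (simp only: funpow.simps comp_apply renorm_eq[of k _ x])
  also have "\<dots> = \<beta> ^ n * renorm k weight x" by (simp add: renorm_eq algebra_simps)
  finally show ?case using renorm_weight[OF Suc.prems] by simp
qed simp

lemma birkhoff_weight_iterate:
  assumes "x \<in> seqs k"
  shows "birkhoff weight (iter_len k n x t) ((subst_seq k ^^ n) x) = \<beta> ^ n * birkhoff weight t x"
proof -
  have "birkhoff weight (iter_len k n x t) ((subst_seq k ^^ n) x)
      = birkhoff (\<lambda>x. \<beta> ^ n * weight x) t x"
    unfolding birkhoff_renorm_pow[symmetric] by (rule birkhoff_cong[OF assms renorm_pow_weight])
  thus ?thesis by (simp add: birkhoff_def sum_distrib_left)
qed

lemma birkhoff_weight_ge: "real n \<le> birkhoff weight n x"
proof -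
  have "(\<Sum>j<n. 1) \<le> birkhoff weight n x"
    unfolding birkhoff_def by (intro sum_mono letter_weight_ge_1)
  thus ?thesis by simp
qed

lemma birkhoff_weight_le: "birkhoff weight n x \<le> \<beta> * real n"
proof -
  have "birkhoff weight n x \<le> (\<Sum>j<n. \<beta>)"
    unfolding birkhoff_def by (intro sum_mono letter_weight_le)
  thus ?thesis by (simp add: mult.commute)
qed

lemma block_length_bounds:
  assumes "x \<in> seqs k"
  shows "real (iter_len k n x 1) \<le> \<beta> ^ n * weight x"
    "\<beta> ^ n * weight x \<le> \<beta> * real (iter_len k n x 1)"
    "real (iter_len k n x 1) \<le> \<beta> ^ Suc n"
proof -
  have *: "birkhoff weight (iter_len k n x 1) ((subst_seq k ^^ n) x) = \<beta> ^ n * weight x"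
    using birkhoff_weight_iterate[OF assms, of n 1] by simp
  show 1: "real (iter_len k n x 1) \<le> \<beta> ^ n * weight x"
    using birkhoff_weight_ge[of "iter_len k n x 1" "(subst_seq k ^^ n) x"] unfolding * .
  show "\<beta> ^ n * weight x \<le> \<beta> * real (iter_len k n x 1)"
    using birkhoff_weight_le[of "iter_len k n x 1" "(subst_seq k ^^ n) x"] unfolding * .
  have "\<beta> ^ n * weight x \<le> \<beta> ^ n * \<beta>"
    using beta_gt_1 letter_weight_le by (intro mult_left_mono) auto
  with 1 show "real (iter_len k n x 1) \<le> \<beta> ^ Suc n" by (simp add: mult.commute)
qed

lemma eventually_beta_pow_ge: "\<exists>n0. \<forall>n\<ge>n0. a \<le> \<beta> ^ n"
proof -
  obtain n0 where n0: "a < \<beta> ^ n0" using real_arch_pow[OF beta_gt_1] by blast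
  have "a \<le> \<beta> ^ n" if "n \<ge> n0" for n
    using n0 power_increasing[OF that, of \<beta>] beta_gt_1 by linarith
  thus ?thesis by blast
qed

text \<open>The \<open>s\<^sup>n\<close>-images of two sequences with the same first letter agree on the whole block, so by
uniform continuity the terms are close except for the last few.\<close>

lemma renorm_pow_close:
  assumes g: "continuous_on (seqs k) g" and "\<epsilon> > 0"
  shows "\<exists>n0. \<forall>n\<ge>n0. \<forall>y\<in>seqs k. \<forall>y'\<in>seqs k. y 0 = y' 0 \<longrightarrow>
    \<bar>(renorm k ^^ n) g y - (renorm k ^^ n) g y'\<bar> \<le> \<epsilon> * \<beta> ^ n"
proof -
  (* a block has at most \<beta> ^ Suc n positions, which share half of the error *)
  define \<eta> where "\<eta> = \<epsilon> / (2 * \<beta>)"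
  have \<eta>: "\<eta> > 0" using assms beta_gt_1 by (simp add: \<eta>_def)
  obtain p where p: "\<And>x y. x \<in> seqs k \<Longrightarrow> y \<in> seqs k \<Longrightarrow> agree p x y \<Longrightarrow> \<bar>g x - g y\<bar> < \<eta>"
    using uniformly_continuous_agree[OF g \<eta>] by blast
  obtain C where C: "C > 0" "\<And>x. x \<in> seqs k \<Longrightarrow> \<bar>g x\<bar> \<le> C" using bounded_on_seqs[OF g] by blast
  obtain n0 where n0: "\<And>n. n \<ge> n0 \<Longrightarrow> 4 * C * real p / \<epsilon> \<le> \<beta> ^ n"
    using eventually_beta_pow_ge by blast
  have "\<bar>(renorm k ^^ n) g y - (renorm k ^^ n) g y'\<bar> \<le> \<epsilon> * \<beta> ^ n"
    if n: "n \<ge> n0" and y: "y \<in> seqs k" "y' \<in> seqs k" "y 0 = y' 0" for n y y'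
  proof -
    define N where "N = iter_len k n y 1"
    let ?g = "\<lambda>j. g ((shift_seq ^^ j) ((subst_seq k ^^ n) y))"
    let ?g' = "\<lambda>j. g ((shift_seq ^^ j) ((subst_seq k ^^ n) y'))"
    have "agree 1 y y'" using y(3) by (simp add: agree_def)
    note ag = agree_subst_pow[OF this, of k n]
    have in_seqs: "(shift_seq ^^ j) ((subst_seq k ^^ n) z) \<in> seqs k" if "z \<in> seqs k" for j z
      using that by (intro shift_seq_in_seqs subst_pow_in_seqs)
    have diff: "(renorm k ^^ n) g y - (renorm k ^^ n) g y' = (\<Sum>j<N. ?g j - ?g' j)"
      using ag by (simp add: renorm_pow_eq_birkhoff birkhoff_def N_def sum_subtractf)
    have split: "{..<N} = {..<N - p} \<union> {N - p..<N}" by auto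
    have "\<bar>\<Sum>j<N. ?g j - ?g' j\<bar> \<le> (\<Sum>j<N. \<bar>?g j - ?g' j\<bar>)" by (rule sum_abs)
    also have "\<dots> = (\<Sum>j<N - p. \<bar>?g j - ?g' j\<bar>) + (\<Sum>j=N - p..<N. \<bar>?g j - ?g' j\<bar>)"
      unfolding split by (rule sum.union_disjoint) auto
    also have "(\<Sum>j<N - p. \<bar>?g j - ?g' j\<bar>) \<le> (\<Sum>j<N - p. \<eta>)"
    proof (rule sum_mono)
      fix j assume j: "j \<in> {..<N - p}"
      have "agree (N - j) ((shift_seq ^^ j) ((subst_seq k ^^ n) y)) ((shift_seq ^^ j) ((subst_seq k ^^ n) y'))"
        using ag agree_shift unfolding N_def by blast
      hence "agree p ((shift_seq ^^ j) ((subst_seq k ^^ n) y)) ((shift_seq ^^ j) ((subst_seq k ^^ n) y'))"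
        by (rule agree_mono) (use j in auto)
      thus "\<bar>?g j - ?g' j\<bar> \<le> \<eta>" using p[OF in_seqs[OF y(1)] in_seqs[OF y(2)]] less_imp_le by blast
    qed
    also have "(\<Sum>j<N - p. \<eta>) \<le> \<eta> * real N" using \<eta> by (simp add: mult.commute)
    also have "(\<Sum>j=N - p..<N. \<bar>?g j - ?g' j\<bar>) \<le> (\<Sum>j=N - p..<N. 2 * C)"
    proof (rule sum_mono)
      fix j
      show "\<bar>?g j - ?g' j\<bar> \<le> 2 * C"
        using C(2)[OF in_seqs[OF y(1), of j]] C(2)[OF in_seqs[OF y(2), of j]] by linarith
    qed
    also have "(\<Sum>j=N - p..<N. 2 * C) = 2 * C * real (N - (N - p))" by simp
    also have "\<dots> \<le> 2 * C * real p" using C(1) by (intro mult_left_mono) auto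
    also have "\<dots> \<le> \<epsilon> / 2 * \<beta> ^ n" using n0[OF n] assms(2) by (simp add: field_simps)
    also have "\<eta> * real N \<le> \<eta> * \<beta> ^ Suc n"
      using block_length_bounds(3)[OF y(1), of n] \<eta> unfolding N_def by (intro mult_left_mono) auto
    also have "\<dots> = \<epsilon> / 2 * \<beta> ^ n" using beta_gt_1 by (simp add: \<eta>_def)
    finally show ?thesis unfolding diff by simp
  qed
  thus ?thesis by blast
qed

text \<open>Multiples of \<open>weight\<close> are the natural bounds here: \<open>weight\<close> is an eigenfunction of \<open>renorm\<close>, which is
monotone, so such bounds pass from \<open>n\<close> to \<open>n + 1\<close>.\<close>

definition band :: "((nat \<Rightarrow> nat) \<Rightarrow> real) \<Rightarrow> nat \<Rightarrow> real \<Rightarrow> real \<Rightarrow> bool" where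
  "band g n m M \<longleftrightarrow> (\<forall>x\<in>seqs k. m * (\<beta> ^ n * weight x) \<le> (renorm k ^^ n) g x \<and>
     (renorm k ^^ n) g x \<le> M * (\<beta> ^ n * weight x))"

lemma band_second_term:
  assumes "band g n m M" "x \<in> seqs k" "x 0 \<noteq> k - 1"
  shows "m * (\<beta> ^ Suc n * (weight x - 1)) \<le> (renorm k ^^ n) g (shift_seq (subst_seq k x))"
    "(renorm k ^^ n) g (shift_seq (subst_seq k x)) \<le> M * (\<beta> ^ Suc n * (weight x - 1))"
proof -
  have "shift_seq (subst_seq k x) \<in> seqs k" using assms(2) by (rule shift_subst_in_seqs)
  with assms(1) have
    "m * (\<beta> ^ n * weight (shift_seq (subst_seq k x))) \<le> (renorm k ^^ n) g (shift_seq (subst_seq k x)) \<and>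
     (renorm k ^^ n) g (shift_seq (subst_seq k x)) \<le> M * (\<beta> ^ n * weight (shift_seq (subst_seq k x)))"
    unfolding band_def by blast
  thus "m * (\<beta> ^ Suc n * (weight x - 1)) \<le> (renorm k ^^ n) g (shift_seq (subst_seq k x))"
    "(renorm k ^^ n) g (shift_seq (subst_seq k x)) \<le> M * (\<beta> ^ Suc n * (weight x - 1))"
    unfolding weight_shift_subst[OF assms(2,3)] by (simp_all add: mult_ac)
qed

lemma band_first_term:
  assumes "band g n m M" "x \<in> seqs k"
  shows "m * \<beta> ^ Suc n \<le> (renorm k ^^ n) g (subst_seq k x)"
    "(renorm k ^^ n) g (subst_seq k x) \<le> M * \<beta> ^ Suc n"
  using assms(1) subst_seq_in_seqs[OF assms(2)] unfolding band_def
  by (auto simp: letter_weight_0 mult.commute)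

lemma band_Suc:
  assumes "band g n m M"
  shows "band g (Suc n) m M"
  unfolding band_def
proof (intro ballI)
  fix x assume x: "x \<in> seqs k"
  note 1 = band_first_term[OF assms x]
  have eq: "K * (\<beta> ^ Suc n * weight x) = K * \<beta> ^ Suc n + K * (\<beta> ^ Suc n * (weight x - 1))" for K
    by (simp add: algebra_simps)
  show "m * (\<beta> ^ Suc n * weight x) \<le> (renorm k ^^ Suc n) g x \<and>
     (renorm k ^^ Suc n) g x \<le> M * (\<beta> ^ Suc n * weight x)"
  proof (cases "x 0 = k - 1")
    case True
    hence "weight x = 1" by (simp only: letter_weight_last)
    thus ?thesis using 1 True unfolding eq by (simp add: renorm_eq)
  next
    case False
    have "(renorm k ^^ Suc n) g x = (renorm k ^^ n) g (subst_seq k x)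
        + (renorm k ^^ n) g (shift_seq (subst_seq k x))"
      using False by (simp add: renorm_eq)
    thus ?thesis using 1 band_second_term[OF assms x False] unfolding eq by linarith
  qed
qed

lemma band_later:
  assumes "band g n m M" "n \<le> n'"
  shows "band g n' m M"
  using assms(2) by (induction n' rule: dec_induct) (auto intro: band_Suc assms(1))

text \<open>The image of any \<open>x\<close> begins with \<open>0\<close>, so up to the error \<open>e\<close> the first term of \<open>renorm\<close> does not
depend on \<open>x\<close>, and it carries the proportion \<open>1 / weight x \<ge> 1 / \<beta>\<close> of the total weight. As in Doeblin's
argument for Markov chains, this common part contracts the width of the band by \<open>1 - 1 / \<beta>\<close>.\<close>

lemma band_contract:
  assumes b: "band g n m M"
    and close: "\<And>y y'. y \<in> seqs k \<Longrightarrow> y' \<in> seqs k \<Longrightarrow> y 0 = y' 0 \<Longrightarrow>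
      \<bar>(renorm k ^^ n) g y - (renorm k ^^ n) g y'\<bar> \<le> e * \<beta> ^ n"
  shows "\<exists>m' M'. band g (Suc n) m' M' \<and> M' - m' \<le> (1 - 1 / \<beta>) * (M - m) + 2 * e / \<beta>"
proof -
  define z :: "nat \<Rightarrow> nat" where "z = (\<lambda>_. 0)"
  have z: "z \<in> seqs k" using k_ge_2 by (simp add: z_def seqs_def)
  define \<phi> where "\<phi> = (renorm k ^^ n) g (subst_seq k z) / \<beta> ^ Suc n"
  have pos: "\<beta> ^ Suc n > 0" using beta_gt_1 by simp
  have \<phi>eq: "(renorm k ^^ n) g (subst_seq k z) = \<phi> * \<beta> ^ Suc n"
    unfolding \<phi>_def using beta_gt_1 by (auto simp del: power_Suc)
  have \<phi>: "m \<le> \<phi>" "\<phi> \<le> M"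
    using band_first_term[OF b z] pos unfolding \<phi>eq by (simp_all only: mult_le_cancel_right_pos)
  have "\<beta> ^ n > 0" using beta_gt_1 by simp
  moreover have "0 \<le> e * \<beta> ^ n" using close[OF z z] by simp
  ultimately have e0: "e \<ge> 0" by (simp add: zero_le_mult_iff)
  (* the proportion 1 / \<beta> of the bound M (or m) is replaced by the common value \<phi> *)
  define m' where "m' = m + (\<phi> - m) / \<beta> - e / \<beta>"
  define M' where "M' = M - (M - \<phi>) / \<beta> + e / \<beta>"
  have "band g (Suc n) m' M'"
    unfolding band_def
  proof (intro ballI)
    fix x assume x: "x \<in> seqs k"
    let ?w = "weight x"
    let ?T = "if x 0 = k - 1 then 0 else (renorm k ^^ n) g (shift_seq (subst_seq k x))"
    have w: "1 \<le> ?w" "?w \<le> \<beta>" by (rule letter_weight_ge_1, rule letter_weight_le)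
    have R: "(renorm k ^^ Suc n) g x = (renorm k ^^ n) g (subst_seq k x) + ?T"
      by (simp add: renorm_eq)
    have T: "m * (\<beta> ^ Suc n * (?w - 1)) \<le> ?T" "?T \<le> M * (\<beta> ^ Suc n * (?w - 1))"
    proof -
      have "m * (\<beta> ^ Suc n * (?w - 1)) \<le> ?T \<and> ?T \<le> M * (\<beta> ^ Suc n * (?w - 1))"
      proof (cases "x 0 = k - 1")
        case True
        hence "?w = 1" by (simp only: letter_weight_last)
        thus ?thesis using True by simp
      next
        case False
        thus ?thesis using band_second_term[OF b x False] by simp
      qed
      thus "m * (\<beta> ^ Suc n * (?w - 1)) \<le> ?T" "?T \<le> M * (\<beta> ^ Suc n * (?w - 1))" by blast+
    qed
    have "\<bar>(renorm k ^^ n) g (subst_seq k x) - \<phi> * \<beta> ^ Suc n\<bar> \<le> e * \<beta> ^ n"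
      using close[OF subst_seq_in_seqs[OF x] subst_seq_in_seqs[OF z]] unfolding \<phi>eq by simp
    also have "e * \<beta> ^ n = e / \<beta> * \<beta> ^ Suc n" using beta_gt_1 by simp
    finally have F: "(renorm k ^^ n) g (subst_seq k x) \<le> \<phi> * \<beta> ^ Suc n + e / \<beta> * \<beta> ^ Suc n"
      "\<phi> * \<beta> ^ Suc n - e / \<beta> * \<beta> ^ Suc n \<le> (renorm k ^^ n) g (subst_seq k x)"
      by linarith+
    have "0 \<le> (M - \<phi>) * (1 - ?w / \<beta>) + e / \<beta> * (?w - 1)"
      using \<phi> w e0 beta_gt_1 by (intro add_nonneg_nonneg mult_nonneg_nonneg) auto
    also have "\<dots> = M' * ?w - (\<phi> + e / \<beta> + M * (?w - 1))"
      unfolding M'_def using beta_gt_1 by (simp add: field_simps)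
    finally have "\<beta> ^ Suc n * (\<phi> + e / \<beta> + M * (?w - 1)) \<le> \<beta> ^ Suc n * (M' * ?w)"
      using pos by (intro mult_left_mono) auto
    hence up: "(renorm k ^^ Suc n) g x \<le> M' * (\<beta> ^ Suc n * ?w)"
      unfolding R using F(1) T(2) by (simp only: algebra_simps)
    have "0 \<le> (\<phi> - m) * (1 - ?w / \<beta>) + e / \<beta> * (?w - 1)"
      using \<phi> w e0 beta_gt_1 by (intro add_nonneg_nonneg mult_nonneg_nonneg) auto
    also have "\<dots> = (\<phi> - e / \<beta> + m * (?w - 1)) - m' * ?w"
      unfolding m'_def using beta_gt_1 by (simp add: field_simps)
    finally have "\<beta> ^ Suc n * (m' * ?w) \<le> \<beta> ^ Suc n * (\<phi> - e / \<beta> + m * (?w - 1))"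
      using pos by (intro mult_left_mono) auto
    hence "m' * (\<beta> ^ Suc n * ?w) \<le> (renorm k ^^ Suc n) g x"
      unfolding R using F(2) T(1) by (simp only: algebra_simps)
    with up show "m' * (\<beta> ^ Suc n * ?w) \<le> (renorm k ^^ Suc n) g x \<and>
        (renorm k ^^ Suc n) g x \<le> M' * (\<beta> ^ Suc n * ?w)" by blast
  qed
  moreover have "M' - m' \<le> (1 - 1 / \<beta>) * (M - m) + 2 * e / \<beta>"
    unfolding M'_def m'_def using beta_gt_1 by (simp add: field_simps)
  ultimately show ?thesis by blast
qed

text \<open>For large \<open>n\<close> the error is at most \<open>\<eta>\<close>, and \<open>2 \<eta>\<close> is the fixed point of the affine recursion
\<open>o \<mapsto> (1 - 1 / \<beta>) o + 2 \<eta> / \<beta>\<close> for the width.\<close>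

lemma bands_shrink:
  assumes g: "continuous_on (seqs k) g" and "\<epsilon> > 0"
  shows "\<exists>n m M. band g n m M \<and> M - m \<le> \<epsilon>"
proof -
  define \<eta> where "\<eta> = \<epsilon> / 4"
  have \<eta>: "\<eta> > 0" using assms by (simp add: \<eta>_def)
  define \<rho> where "\<rho> = 1 - 1 / \<beta>"
  have \<rho>: "0 \<le> \<rho>" "\<rho> < 1" using beta_gt_1 by (auto simp: \<rho>_def)
  obtain n0 where n0: "\<And>n y y'. n \<ge> n0 \<Longrightarrow> y \<in> seqs k \<Longrightarrow> y' \<in> seqs k \<Longrightarrow> y 0 = y' 0 \<Longrightarrow>
      \<bar>(renorm k ^^ n) g y - (renorm k ^^ n) g y'\<bar> \<le> \<eta> * \<beta> ^ n"
    using renorm_pow_close[OF g \<eta>] by blast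
  obtain C where C: "C > 0" "\<And>x. x \<in> seqs k \<Longrightarrow> \<bar>g x\<bar> \<le> C" using bounded_on_seqs[OF g] by blast
  have "band g 0 (- C) C"
    unfolding band_def
  proof (intro ballI)
    fix x assume "x \<in> seqs k"
    moreover have "C * 1 \<le> C * weight x"
      using C(1) letter_weight_ge_1 by (intro mult_left_mono) auto
    ultimately show "- C * (\<beta> ^ 0 * weight x) \<le> (renorm k ^^ 0) g x \<and>
        (renorm k ^^ 0) g x \<le> C * (\<beta> ^ 0 * weight x)" using C(2)[of x] by (simp add: abs_le_iff)
  qed
  hence start: "band g n0 (- C) C" by (rule band_later) simp
  have "\<exists>m M. band g (n0 + i) m M \<and> M - m \<le> \<rho> ^ i * (2 * C) + 2 * \<eta>" for i
  proof (induction i)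
    case 0
    show ?case using start \<eta> by (intro exI[of _ "- C"] exI[of _ C]) simp
  next
    case (Suc i)
    then obtain m M where mM: "band g (n0 + i) m M" "M - m \<le> \<rho> ^ i * (2 * C) + 2 * \<eta>" by blast
    have "\<exists>m' M'. band g (Suc (n0 + i)) m' M' \<and> M' - m' \<le> (1 - 1 / \<beta>) * (M - m) + 2 * \<eta> / \<beta>"
      by (rule band_contract[OF mM(1)]) (rule n0, auto)
    then obtain m' M' where *: "band g (Suc (n0 + i)) m' M'"
      "M' - m' \<le> \<rho> * (M - m) + 2 * \<eta> / \<beta>" unfolding \<rho>_def by blast
    have "\<rho> * (M - m) \<le> \<rho> * (\<rho> ^ i * (2 * C) + 2 * \<eta>)" using mM(2) \<rho>(1) by (rule mult_left_mono)
    moreover have "\<rho> * (2 * \<eta>) + 2 * \<eta> / \<beta> = 2 * \<eta>" by (simp add: \<rho>_def algebra_simps)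
    ultimately have "M' - m' \<le> \<rho> ^ Suc i * (2 * C) + 2 * \<eta>" using *(2) by (simp add: algebra_simps)
    thus ?case using *(1) by auto
  qed
  moreover obtain i where i: "\<rho> ^ i < 2 * \<eta> / (2 * C)"
    using real_arch_pow_inv[of "2 * \<eta> / (2 * C)" \<rho>] \<rho> \<eta> C(1) by auto
  moreover have "\<rho> ^ i * (2 * C) \<le> 2 * \<eta>" using i C(1) by (simp add: field_simps)
  ultimately obtain m M where "band g (n0 + i) m M" "M - m \<le> 2 * \<eta> + 2 * \<eta>" by force
  thus ?thesis unfolding \<eta>_def by auto
qed

text \<open>Bands remain valid for all larger \<open>n\<close> and shrink, which forces convergence of the ratios, uniformly
in \<open>x\<close>. This is the quantitative form of unique ergodicity on which the limits rest.\<close>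

lemma renorm_pow_asymptotics:
  assumes g: "continuous_on (seqs k) g"
  obtains c where "\<And>\<epsilon>. \<epsilon> > 0 \<Longrightarrow> \<exists>n0. \<forall>n\<ge>n0. \<forall>x\<in>seqs k.
    \<bar>(renorm k ^^ n) g x - c * (\<beta> ^ n * weight x)\<bar> \<le> \<epsilon> * (\<beta> ^ n * weight x)"
proof -
  define z :: "nat \<Rightarrow> nat" where "z = (\<lambda>_. 0)"
  have z: "z \<in> seqs k" using k_ge_2 by (simp add: z_def seqs_def)
  have W: "\<beta> ^ n * weight x > 0" for n x using beta_gt_1 letter_weight_pos by simp
  define a where "a n = (renorm k ^^ n) g z / (\<beta> ^ n * weight z)" for n
  have a: "m \<le> a n" "a n \<le> M" if "band g n m M" for n m M
    using that z W[of n z] unfolding a_def band_def by (simp_all add: pos_le_divide_eq pos_divide_le_eq)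
  have "Cauchy a"
  proof (rule CauchyI')
    fix e :: real assume "e > 0"
    hence "e / 2 > 0" by simp
    then obtain n0 m M where n0: "band g n0 m M" "M - m \<le> e / 2" using bands_shrink[OF g] by blast
    have "dist (a n) (a n') < e" if "n \<ge> n0" "n' > n" for n n'
    proof -
      have "band g n m M" "band g n' m M" using band_later[OF n0(1)] that by auto
      thus ?thesis using a[of n m M] a[of n' m M] n0(2) \<open>e > 0\<close> by (auto simp: dist_real_def)
    qed
    thus "\<exists>M. \<forall>m\<ge>M. \<forall>n>m. dist (a m) (a n) < e" by blast
  qed
  then obtain c where c: "a \<longlonglongrightarrow> c" using Cauchy_convergent convergent_def by blast
  have "\<exists>n0. \<forall>n\<ge>n0. \<forall>x\<in>seqs k.
    \<bar>(renorm k ^^ n) g x - c * (\<beta> ^ n * weight x)\<bar> \<le> \<epsilon> * (\<beta> ^ n * weight x)" if "\<epsilon> > 0" for \<epsilon>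
  proof -
    obtain n0 m M where n0: "band g n0 m M" "M - m \<le> \<epsilon>" using bands_shrink[OF g \<open>\<epsilon> > 0\<close>] by blast
    have c_in: "m \<le> c" "c \<le> M"
      using a[OF band_later[OF n0(1)]] by (blast intro: LIMSEQ_le_const[OF c] LIMSEQ_le_const2[OF c])+
    have "\<bar>(renorm k ^^ n) g x - c * (\<beta> ^ n * weight x)\<bar> \<le> \<epsilon> * (\<beta> ^ n * weight x)"
      if "n \<ge> n0" "x \<in> seqs k" for n x
    proof -
      let ?W = "\<beta> ^ n * weight x"
      have "m * ?W \<le> (renorm k ^^ n) g x" "(renorm k ^^ n) g x \<le> M * ?W"
        using band_later[OF n0(1) that(1)] that(2) unfolding band_def by auto
      moreover have "m * ?W \<le> c * ?W" "c * ?W \<le> M * ?W"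
        using c_in W[of n x] by (auto intro!: mult_right_mono)
      moreover have "(M - m) * ?W \<le> \<epsilon> * ?W"
        using n0(2) W[of n x] by (intro mult_right_mono) auto
      ultimately show ?thesis by (simp only: left_diff_distrib)
    qed
    thus ?thesis by blast
  qed
  thus ?thesis by (rule that)
qed

text \<open>A substitute for \<open>\<integral> f d\<mu> = 0\<close> that refers to blocks only; \<open>integral_null_mean\<close> gives the link with
invariant measures.\<close>

definition null_mean :: "((nat \<Rightarrow> nat) \<Rightarrow> real) \<Rightarrow> bool" where
  "null_mean f \<longleftrightarrow> continuous_on (seqs k) f \<and>
    (\<forall>\<epsilon>>0. \<exists>n0. \<forall>n\<ge>n0. \<forall>x\<in>seqs k. \<bar>(renorm k ^^ n) f x\<bar> \<le> \<epsilon> * (\<beta> ^ n * weight x))"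

lemma continuous_weight: "continuous_on S weight"
proof (rule continuous_on_agreeI)
  fix x :: "nat \<Rightarrow> nat" and e :: real assume "e > 0"
  thus "\<exists>n. \<forall>y\<in>S. agree n x y \<longrightarrow> \<bar>weight y - weight x\<bar> < e"
    by (intro exI[of _ 1]) (simp add: agree_def)
qed

lemma renorm_pow_diff_scaled:
  "(renorm k ^^ n) (\<lambda>x. f x - c * g x) x = (renorm k ^^ n) f x - c * (renorm k ^^ n) g x"
  by (simp only: renorm_pow_eq_birkhoff birkhoff_diff)

lemma renorm_pow_1: "(renorm k ^^ n) (\<lambda>_. 1) x = real (iter_len k n x 1)"
  by (simp add: renorm_pow_eq_birkhoff)

text \<open>Block lengths are the iterates of \<open>renorm\<close> at the constant \<open>1\<close>. Their growth rate \<open>c\<close> is positive since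
\<open>1 \<ge> weight x / \<beta>\<close>.\<close>

lemma block_length_asymptotics:
  obtains c where "c > 0" "null_mean (\<lambda>x. 1 - c * weight x)"
proof -
  obtain c where c: "\<And>\<epsilon>. \<epsilon> > 0 \<Longrightarrow> \<exists>n0. \<forall>n\<ge>n0. \<forall>x\<in>seqs k.
    \<bar>(renorm k ^^ n) (\<lambda>_. 1) x - c * (\<beta> ^ n * weight x)\<bar> \<le> \<epsilon> * (\<beta> ^ n * weight x)"
    using renorm_pow_asymptotics[of "\<lambda>_. 1"] by auto
  define z :: "nat \<Rightarrow> nat" where "z = (\<lambda>_. 0)"
  have z: "z \<in> seqs k" using k_ge_2 by (simp add: z_def seqs_def)
  have "c > 0"
  proof (rule ccontr)
    assume "\<not> c > 0"
    have e: "1 / (2 * \<beta>) > 0" using beta_gt_1 by simp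
    then obtain n where n: "\<bar>(renorm k ^^ n) (\<lambda>_. 1) z - c * (\<beta> ^ n * weight z)\<bar>
        \<le> 1 / (2 * \<beta>) * (\<beta> ^ n * weight z)"
      using c[OF e] z by blast
    (* the block length is at least ?W / \<beta>, twice the error allowed *)
    let ?W = "\<beta> ^ n * weight z"
    have W: "?W > 0" using beta_gt_1 letter_weight_pos by simp
    have "?W / \<beta> \<le> (renorm k ^^ n) (\<lambda>_. 1) z"
      using block_length_bounds(2)[OF z, of n] beta_gt_1 unfolding renorm_pow_1
      by (simp add: field_simps)
    moreover have "c * ?W \<le> 0" using \<open>\<not> c > 0\<close> W by (intro mult_nonpos_nonneg) auto
    moreover have "?W / \<beta> = 1 / (2 * \<beta>) * ?W + 1 / (2 * \<beta>) * ?W" using beta_gt_1 by (simp add: field_simps)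
    moreover have "1 / (2 * \<beta>) * ?W > 0" using W e by (rule mult_pos_pos[rotated])
    ultimately show False using n by linarith
  qed
  moreover have "null_mean (\<lambda>x. 1 - c * weight x)"
    unfolding null_mean_def
  proof (intro conjI allI impI)
    show "continuous_on (seqs k) (\<lambda>x. 1 - c * weight x)"
      by (intro continuous_intros continuous_weight)
    fix \<epsilon> :: real assume "\<epsilon> > 0"
    from c[OF this] show "\<exists>n0. \<forall>n\<ge>n0. \<forall>x\<in>seqs k.
        \<bar>(renorm k ^^ n) (\<lambda>x. 1 - c * weight x) x\<bar> \<le> \<epsilon> * (\<beta> ^ n * weight x)"
      by (simp add: renorm_pow_diff_scaled renorm_pow_weight)
  qed
  ultimately show ?thesis by (rule that)
qed

text \<open>The mean is the ratio of the asymptotic constants of \<open>g\<close> and of \<open>1\<close>.\<close>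

lemma null_mean_exists:
  assumes g: "continuous_on (seqs k) g"
  obtains m where "null_mean (\<lambda>x. g x - m)"
proof -
  obtain c where c: "c > 0" "null_mean (\<lambda>x. 1 - c * weight x)" using block_length_asymptotics by blast
  obtain d where d: "\<And>\<epsilon>. \<epsilon> > 0 \<Longrightarrow> \<exists>n0. \<forall>n\<ge>n0. \<forall>x\<in>seqs k.
    \<bar>(renorm k ^^ n) g x - d * (\<beta> ^ n * weight x)\<bar> \<le> \<epsilon> * (\<beta> ^ n * weight x)"
    using renorm_pow_asymptotics[OF g] by blast
  define m where "m = d / c"
  have "null_mean (\<lambda>x. g x - m * 1)"
    unfolding null_mean_def
  proof (intro conjI allI impI)
    show "continuous_on (seqs k) (\<lambda>x. g x - m * 1)" by (intro continuous_intros g)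
    fix \<epsilon> :: real assume "\<epsilon> > 0"
    define e where "e = \<epsilon> / (1 + \<bar>m\<bar>)"
    have e: "e > 0" using \<open>\<epsilon> > 0\<close> by (simp add: e_def)
    obtain n1 where n1: "\<And>n x. n \<ge> n1 \<Longrightarrow> x \<in> seqs k \<Longrightarrow>
      \<bar>(renorm k ^^ n) g x - d * (\<beta> ^ n * weight x)\<bar> \<le> e * (\<beta> ^ n * weight x)" using d[OF e] by blast
    obtain n2 where n2: "\<And>n x. n \<ge> n2 \<Longrightarrow> x \<in> seqs k \<Longrightarrow>
      \<bar>(renorm k ^^ n) (\<lambda>x. 1 - c * weight x) x\<bar> \<le> e * (\<beta> ^ n * weight x)"
      using c(2) e unfolding null_mean_def by blast
    have "\<bar>(renorm k ^^ n) (\<lambda>x. g x - m * 1) x\<bar> \<le> \<epsilon> * (\<beta> ^ n * weight x)"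
      if n: "n \<ge> max n1 n2" and x: "x \<in> seqs k" for n x
    proof -
      let ?W = "\<beta> ^ n * weight x" and ?N = "(renorm k ^^ n) (\<lambda>_. 1) x"
      have "(renorm k ^^ n) (\<lambda>x. g x - m * 1) x = (renorm k ^^ n) g x - m * ?N"
        by (rule renorm_pow_diff_scaled)
      also have "\<dots> = ((renorm k ^^ n) g x - d * ?W) - m * (?N - c * ?W)"
        using c(1) by (simp add: m_def field_simps)
      also have "\<bar>\<dots>\<bar> \<le> \<bar>(renorm k ^^ n) g x - d * ?W\<bar> + \<bar>m\<bar> * \<bar>?N - c * ?W\<bar>"
        unfolding abs_mult[symmetric] by (rule abs_triangle_ineq4)
      also have "\<bar>?N - c * ?W\<bar> \<le> e * ?W"
        using n2[OF _ x, of n] n unfolding renorm_pow_diff_scaled renorm_pow_weight[OF x] by simp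
      also have "\<bar>(renorm k ^^ n) g x - d * ?W\<bar> \<le> e * ?W" using n1[OF _ x, of n] n by simp
      also have "e * ?W + \<bar>m\<bar> * (e * ?W) = (e * (1 + \<bar>m\<bar>)) * ?W" by (simp add: algebra_simps)
      also have "e * (1 + \<bar>m\<bar>) = \<epsilon>" unfolding e_def by simp
      finally show ?thesis by (simp add: mult_left_mono)
    qed
    thus "\<exists>n0. \<forall>n\<ge>n0. \<forall>x\<in>seqs k.
        \<bar>(renorm k ^^ n) (\<lambda>x. g x - m * 1) x\<bar> \<le> \<epsilon> * (\<beta> ^ n * weight x)" by blast
  qed
  thus ?thesis using that[of m] by simp
qed

text \<open>A long orbit segment of \<open>s\<^sup>q z\<close> is a concatenation of full \<open>s\<^sup>q\<close>-blocks, each with a small sum,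
and of a remainder of length at most \<open>\<beta>\<^bsup>q + 1\<^esup>\<close>.\<close>

lemma null_mean_birkhoff:
  assumes f: "null_mean f" and "\<epsilon> > 0"
  obtains q K where "K \<ge> 0"
    "\<And>z N. z \<in> seqs k \<Longrightarrow> \<bar>birkhoff f N ((subst_seq k ^^ q) z)\<bar> \<le> \<epsilon> * real N + K"
proof -
  have cont: "continuous_on (seqs k) f" using f by (simp add: null_mean_def)
  obtain C where C: "C > 0" "\<And>x. x \<in> seqs k \<Longrightarrow> \<bar>f x\<bar> \<le> C" using bounded_on_seqs[OF cont] by blast
  have e: "\<epsilon> / \<beta> > 0" using assms(2) beta_gt_1 by simp
  then obtain q where q: "\<And>x. x \<in> seqs k \<Longrightarrow> \<bar>(renorm k ^^ q) f x\<bar> \<le> \<epsilon> / \<beta> * (\<beta> ^ q * weight x)"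
    using f unfolding null_mean_def by blast
  define K where "K = C * \<beta> ^ Suc q"
  have "\<bar>birkhoff f N ((subst_seq k ^^ q) z)\<bar> \<le> \<epsilon> * real N + K" if z: "z \<in> seqs k" for z N
  proof -
    obtain t e where te: "N = iter_len k q z t + e" "e < iter_len k q ((shift_seq ^^ t) z) 1"
      using position_in_iterate by blast
    let ?P = "iter_len k q z t" and ?y = "(subst_seq k ^^ q) z"
    have "\<bar>birkhoff f ?P ?y\<bar> \<le> birkhoff (\<lambda>x. \<epsilon> / \<beta> * (\<beta> ^ q * weight x)) t z"
      unfolding birkhoff_renorm_pow[symmetric] by (rule abs_birkhoff_le[OF z q])
    also have "\<dots> = \<epsilon> / \<beta> * (\<beta> ^ q * birkhoff weight t z)"
      by (simp add: birkhoff_def sum_distrib_left)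
    also have "\<beta> ^ q * birkhoff weight t z = birkhoff weight ?P ?y"
      by (rule birkhoff_weight_iterate[OF z, symmetric])
    also have "\<epsilon> / \<beta> * birkhoff weight ?P ?y \<le> \<epsilon> / \<beta> * (\<beta> * real ?P)"
      using e by (intro mult_left_mono birkhoff_weight_le) auto
    also have "\<dots> = \<epsilon> * real ?P" using beta_gt_1 by simp
    finally have 1: "\<bar>birkhoff f ?P ?y\<bar> \<le> \<epsilon> * real ?P" .
    have "\<bar>birkhoff f e ((shift_seq ^^ ?P) ?y)\<bar> \<le> birkhoff (\<lambda>_. C) e ((shift_seq ^^ ?P) ?y)"
      by (intro abs_birkhoff_le[where k = k] C(2) shift_seq_in_seqs subst_pow_in_seqs z)
    also have "\<dots> = real e * C" by simp
    also have "\<dots> \<le> \<beta> ^ Suc q * C"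
      using block_length_bounds(3)[OF shift_seq_in_seqs[OF z], of q t] te(2) C(1)
      by (intro mult_right_mono) auto
    finally have 2: "\<bar>birkhoff f e ((shift_seq ^^ ?P) ?y)\<bar> \<le> K" by (simp add: K_def mult.commute)
    have "\<epsilon> * real ?P \<le> \<epsilon> * real N" using te(1) assms(2) by (intro mult_left_mono) auto
    thus ?thesis using 1 2 unfolding te(1) birkhoff_add by linarith
  qed
  moreover have "K \<ge> 0" using C(1) beta_gt_1 by (simp add: K_def)
  ultimately show ?thesis using that by blast
qed

text \<open>Shifts of \<open>\<omega> = s\<^sup>q \<omega>\<close> start inside some block, which costs a bounded error; points of the
subshift are approximated by such shifts.\<close>

lemma birkhoff_on_subst_space:
  assumes f: "null_mean f" and "\<epsilon> > 0"
  obtains K where "\<And>y N. y \<in> subst_space k \<Longrightarrow> \<bar>birkhoff f N y\<bar> \<le> \<epsilon> * real N + K"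
proof -
  have cont: "continuous_on (seqs k) f" using f by (simp add: null_mean_def)
  have e: "\<epsilon> / 2 > 0" using assms(2) by simp
  obtain q K where K: "K \<ge> 0"
    "\<And>z N. z \<in> seqs k \<Longrightarrow> \<bar>birkhoff f N ((subst_seq k ^^ q) z)\<bar> \<le> \<epsilon> / 2 * real N + K"
    by (rule null_mean_birkhoff[OF f e]) blast
  obtain p where p: "\<And>x y. x \<in> seqs k \<Longrightarrow> y \<in> seqs k \<Longrightarrow> agree p x y \<Longrightarrow> \<bar>f x - f y\<bar> < \<epsilon> / 2"
    using uniformly_continuous_agree[OF cont e] by blast
  (* the offset i inside the block enters two sums and is less than \<beta> ^ Suc q *)
  define L where "L = 2 * K + \<epsilon> * \<beta> ^ Suc q"
  have orbit: "\<bar>birkhoff f N ((shift_seq ^^ M) (omega k))\<bar> \<le> \<epsilon> / 2 * real N + L" for M N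
  proof -
    obtain t i where ti: "M = iter_len k q (omega k) t + i"
      "i < iter_len k q ((shift_seq ^^ t) (omega k)) 1"
      using position_in_iterate by blast
    define z where "z = (shift_seq ^^ t) (omega k)"
    have z: "z \<in> seqs k" unfolding z_def by (intro shift_seq_in_seqs omega_in_seqs)
    have "(shift_seq ^^ M) (omega k) = (shift_seq ^^ i) ((subst_seq k ^^ q) z)"
      unfolding ti(1) shift_seq_pow_add z_def shift_subst_pow[symmetric] subst_pow_omega ..
    moreover have "birkhoff f N ((shift_seq ^^ i) ((subst_seq k ^^ q) z)) =
        birkhoff f (i + N) ((subst_seq k ^^ q) z) - birkhoff f i ((subst_seq k ^^ q) z)"
      by (simp add: birkhoff_add)
    ultimately have "birkhoff f N ((shift_seq ^^ M) (omega k)) =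
        birkhoff f (i + N) ((subst_seq k ^^ q) z) - birkhoff f i ((subst_seq k ^^ q) z)" by simp
    hence "\<bar>birkhoff f N ((shift_seq ^^ M) (omega k))\<bar>
        \<le> (\<epsilon> / 2 * real (i + N) + K) + (\<epsilon> / 2 * real i + K)"
      using K(2)[OF z, of "i + N"] K(2)[OF z, of i] by linarith
    also have "\<dots> = \<epsilon> / 2 * real N + 2 * K + \<epsilon> * real i" by (simp add: field_simps)
    also have "\<epsilon> * real i \<le> \<epsilon> * \<beta> ^ Suc q"
      using block_length_bounds(3)[OF z, of q] ti(2) assms(2) unfolding z_def[symmetric]
      by (intro mult_left_mono) auto
    finally show ?thesis by (simp add: L_def)
  qed
  have "\<bar>birkhoff f N y\<bar> \<le> \<epsilon> * real N + L" if y: "y \<in> subst_space k" for y N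
  proof -
    have "legal (N + p) y" using y by (simp add: subst_space_iff)
    then obtain M where M: "agree (N + p) y ((shift_seq ^^ M) (omega k))" by (auto simp: legal_def)
    let ?y = "(shift_seq ^^ M) (omega k)"
    have in_seqs: "y \<in> seqs k" "?y \<in> seqs k"
      using y subst_space_subset shift_seq_in_seqs omega_in_seqs by auto
    have "\<bar>birkhoff f N y - birkhoff f N ?y\<bar> \<le> (\<Sum>j<N. \<bar>f ((shift_seq ^^ j) y) - f ((shift_seq ^^ j) ?y)\<bar>)"
      unfolding birkhoff_def sum_subtractf[symmetric] by (rule sum_abs)
    also have "\<dots> \<le> (\<Sum>j<N. \<epsilon> / 2)"
    proof (rule sum_mono)
      fix j assume "j \<in> {..<N}"
      hence "agree p ((shift_seq ^^ j) y) ((shift_seq ^^ j) ?y)"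
        by (intro agree_mono[OF agree_shift[OF M, of j]]) auto
      thus "\<bar>f ((shift_seq ^^ j) y) - f ((shift_seq ^^ j) ?y)\<bar> \<le> \<epsilon> / 2"
        using p in_seqs shift_seq_in_seqs less_imp_le by blast
    qed
    also have "\<dots> = \<epsilon> / 2 * real N" by simp
    finally show ?thesis using orbit[of N M] by (simp only: mult_2_right field_sum_of_halves)
  qed
  thus ?thesis by (rule that)
qed

text \<open>By invariance the integral of a Birkhoff sum of length \<open>N\<close> is \<open>N\<close> times the integral, while the sum
itself is uniformly \<open>o(N)\<close>.\<close>

lemma integral_null_mean:
  assumes f: "null_mean f" and \<mu>: "ergodic_prob_on (subst_space k) shift_seq \<mu>"
  shows "has_bochner_integral \<mu> f 0"
proof -
  interpret prob_space \<mu> using \<mu> by (simp add: ergodic_prob_on_def)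
  have sets: "sets \<mu> = sets (restrict_space borel (subst_space k))"
    and shift: "shift_seq \<in> measurable \<mu> \<mu>" and inv: "distr \<mu> \<mu> shift_seq = \<mu>"
    using \<mu> by (auto simp: ergodic_prob_on_def)
  have space: "space \<mu> = subst_space k"
    using sets_eq_imp_space_eq[OF sets] by (simp add: space_restrict_space)
  have cont: "continuous_on (seqs k) f" using f by (simp add: null_mean_def)
  obtain C where C: "C > 0" "\<And>x. x \<in> seqs k \<Longrightarrow> \<bar>f x\<bar> \<le> C" using bounded_on_seqs[OF cont] by blast
  have "f \<in> borel_measurable (restrict_space borel (subst_space k))"
    by (rule borel_measurable_continuous_on_restrict) (rule continuous_on_subset[OF cont subst_space_subset])
  hence meas: "f \<in> borel_measurable \<mu>" using measurable_cong_sets[OF sets refl] by blast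
  have pow: "(shift_seq ^^ j) \<in> measurable \<mu> \<mu>" for j
  proof (induction j)
    case (Suc j)
    show ?case using measurable_comp[OF Suc shift] by (simp only: funpow.simps)
  qed (simp add: id_def)
  have inv_pow: "distr \<mu> \<mu> (shift_seq ^^ j) = \<mu>" for j
  proof (induction j)
    case 0
    show ?case by (simp add: id_def)
  next
    case (Suc j)
    have "distr \<mu> \<mu> (shift_seq ^^ Suc j) = distr (distr \<mu> \<mu> (shift_seq ^^ j)) \<mu> shift_seq"
      unfolding distr_distr[OF shift pow] by simp
    thus ?case by (simp only: Suc.IH inv)
  qed
  have int_shift: "(\<integral>y. f ((shift_seq ^^ j) y) \<partial>\<mu>) = (\<integral>y. f y \<partial>\<mu>)" for j
    using integral_distr[OF pow meas, of j] by (simp add: inv_pow)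
  have integrable: "integrable \<mu> (\<lambda>y. f ((shift_seq ^^ j) y))" for j
  proof (rule integrable_const_bound[where B = C])
    show "AE y in \<mu>. norm (f ((shift_seq ^^ j) y)) \<le> C"
      using C(2) subst_space_shift subst_space_subset space by (intro AE_I2) auto
    show "(\<lambda>y. f ((shift_seq ^^ j) y)) \<in> borel_measurable \<mu>"
      using measurable_comp[OF pow meas] by (simp add: comp_def)
  qed
  have sum: "(\<integral>y. birkhoff f N y \<partial>\<mu>) = real N * (\<integral>y. f y \<partial>\<mu>)" for N
    unfolding birkhoff_def by (simp add: Bochner_Integration.integral_sum integrable int_shift)
  have "\<bar>\<integral>y. f y \<partial>\<mu>\<bar> \<le> 0 + \<epsilon>" if \<epsilon>: "\<epsilon> > 0" for \<epsilon>
  proof -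
    have "\<epsilon> / 2 > 0" using \<epsilon> by simp
    then obtain K where K: "\<And>y N. y \<in> subst_space k \<Longrightarrow> \<bar>birkhoff f N y\<bar> \<le> \<epsilon> / 2 * real N + K"
      using birkhoff_on_subst_space[OF f] by blast
    obtain N :: nat where N: "2 * \<bar>K\<bar> / \<epsilon> + 1 < real N" using reals_Archimedean2 by blast
    have N0: "0 < real N" using N \<epsilon> by (smt (verit) divide_nonneg_pos)
    have "real N * \<bar>\<integral>y. f y \<partial>\<mu>\<bar> = \<bar>\<integral>y. birkhoff f N y \<partial>\<mu>\<bar>" by (simp add: sum abs_mult)
    also have "\<dots> \<le> (\<integral>y. \<bar>birkhoff f N y\<bar> \<partial>\<mu>)" by (rule integral_abs_bound)
    also have "\<dots> \<le> (\<integral>y. \<epsilon> / 2 * real N + K \<partial>\<mu>)"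
      using K space by (intro integral_mono integrable_abs integrable_const)
        (auto simp: birkhoff_def intro!: Bochner_Integration.integrable_sum integrable)
    also have "\<dots> = \<epsilon> / 2 * real N + K" by (simp add: prob_space)
    also have "\<dots> \<le> \<epsilon> / 2 * real N + \<epsilon> / 2 * real N"
    proof -
      have "\<bar>K\<bar> / (\<epsilon> / 2) \<le> real N" using N by (simp add: mult.commute)
      hence "\<bar>K\<bar> \<le> real N * (\<epsilon> / 2)" using \<epsilon> by (simp only: pos_divide_le_eq half_gt_zero)
      thus ?thesis by (simp add: mult.commute)
    qed
    also have "\<dots> = real N * \<epsilon>" by simp
    finally show ?thesis using N0 by simp
  qed
  hence "\<bar>\<integral>y. f y \<partial>\<mu>\<bar> \<le> 0" by (rule field_le_epsilon)
  moreover have "integrable \<mu> f" using integrable[of 0] by simp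
  ultimately show ?thesis by (simp add: has_bochner_integral_iff)
qed

end

section \<open>Sums of powers of an arithmetic progression\<close>

text \<open>Telescoping of \<open>ln ((d + 1) / d) \<le> 1 / d \<le> ln (d / (d - 1))\<close>.\<close>

lemma harmonic_block_bounds:
  assumes "N < D"
  shows "(\<Sum>j<N. 1 / real (D - j)) \<le> ln (real D / (real D - real N))"
    "ln ((real D + 1) / (real D + 1 - real N)) \<le> (\<Sum>j<N. 1 / real (D - j))"
proof -
  have "(\<Sum>j<N. 1 / real (D - j)) \<le> ln (real D / (real D - real N)) \<and>
    ln ((real D + 1) / (real D + 1 - real N)) \<le> (\<Sum>j<N. 1 / real (D - j))"
    using assms
  proof (induction N)
    case (Suc N)
    define d where "d = real D - real N"
    have d: "d > 1" "real (D - N) = d" using Suc.prems by (auto simp: d_def of_nat_diff)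
    have D: "real D > 0" using Suc.prems by simp
    have "ln (real D / d) + ln (d / (d - 1)) = ln (real D / (d - 1))"
      using d D by (simp add: ln_div)
    moreover have "1 / d \<le> ln (d / (d - 1))"
    proof -
      have "ln ((d - 1) / d) \<le> (d - 1) / d - 1" using d by (intro ln_le_minus_one) auto
      thus ?thesis using d by (simp add: ln_div field_simps)
    qed
    moreover have "ln ((real D + 1) / (d + 1)) + ln ((d + 1) / d) = ln ((real D + 1) / d)"
      using d D by (simp add: ln_div)
    moreover have "ln ((d + 1) / d) \<le> 1 / d"
    proof -
      have "ln ((d + 1) / d) \<le> (d + 1) / d - 1" using d by (intro ln_le_minus_one) auto
      thus ?thesis using d by (simp add: field_simps)
    qed
    moreover have eqs: "real D - real (Suc N) = d - 1" "real D + 1 - real (Suc N) = d"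
      "real D - real N = d" "real D + 1 - real N = d + 1" by (simp_all add: d_def)
    moreover have "(\<Sum>j<N. 1 / real (D - j)) \<le> ln (real D / d) \<and>
        ln ((real D + 1) / (d + 1)) \<le> (\<Sum>j<N. 1 / real (D - j))"
      using Suc unfolding eqs by simp
    moreover have "(\<Sum>j<Suc N. 1 / real (D - j)) = (\<Sum>j<N. 1 / real (D - j)) + 1 / d"
      by (simp only: sum.lessThan_Suc d(2))
    ultimately show ?case unfolding eqs by linarith
  qed simp
  thus "(\<Sum>j<N. 1 / real (D - j)) \<le> ln (real D / (real D - real N))"
    "ln ((real D + 1) / (real D + 1 - real N)) \<le> (\<Sum>j<N. 1 / real (D - j))" by blast+
qed

text \<open>Summation by parts: monotone weights transfer bounds on partial sums.\<close>

lemma abs_weighted_sum_le: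
  fixes f a :: "nat \<Rightarrow> real"
  assumes partial: "\<And>i. i \<le> N \<Longrightarrow> \<bar>\<Sum>j<i. f j\<bar> \<le> F"
    and mono: "\<And>j. j < N \<Longrightarrow> a j \<le> a (Suc j)" and nonneg: "0 \<le> a 0"
  shows "\<bar>\<Sum>j<N. f j * a j\<bar> \<le> 2 * F * a N"
proof -
  define S where "S i = (\<Sum>j<i. f j)" for i
  have abel: "(\<Sum>j<n. f j * a j) = S n * a n - (\<Sum>j<n. S (Suc j) * (a (Suc j) - a j))" for n
    by (induction n) (simp_all add: S_def algebra_simps)
  have S: "\<bar>S i\<bar> \<le> F" if "i \<le> N" for i using partial[OF that] by (simp add: S_def)
  have F: "F \<ge> 0" using S[of 0] by (simp add: S_def)
  have "0 \<le> a n" if "n \<le> N" for n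
    using that nonneg mono by (induction n) (auto intro: order.trans[OF _ mono])
  hence aN: "0 \<le> a N" by simp
  have "\<bar>\<Sum>j<N. S (Suc j) * (a (Suc j) - a j)\<bar> \<le> (\<Sum>j<N. F * (a (Suc j) - a j))"
  proof (rule order.trans[OF sum_abs sum_mono])
    fix j assume "j \<in> {..<N}"
    thus "\<bar>S (Suc j) * (a (Suc j) - a j)\<bar> \<le> F * (a (Suc j) - a j)"
      using S[of "Suc j"] mono[of j] unfolding abs_mult by (intro mult_mono) auto
  qed
  also have "\<dots> = F * (a N - a 0)"
    by (simp add: sum_distrib_left[symmetric] sum_lessThan_telescope)
  also have "\<dots> \<le> F * a N" using F nonneg by (intro mult_left_mono) auto
  finally have 1: "\<bar>\<Sum>j<N. S (Suc j) * (a (Suc j) - a j)\<bar> \<le> F * a N" .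
  have "\<bar>S N * a N\<bar> \<le> F * a N" using S[of N] aN by (simp add: abs_mult mult_right_mono)
  thus ?thesis using 1 unfolding abel by linarith
qed

lemma power_at_top:
  fixes b :: real
  assumes "b > 1"
  shows "filterlim (\<lambda>n. b ^ n) at_top sequentially"
  using assms
  by (intro filterlim_at_infinity_imp_filterlim_at_top filterlim_realpow_sequentially_gt1) auto

text \<open>Lets \<open>a\<close> and \<open>E\<close>, which both grow like \<open>\<beta>\<^sup>n\<close>, be replaced by convergent quantities, leaving a power
whose base is below or above \<open>1\<close> according to whether \<open>\<alpha> > 1\<close> or \<open>\<alpha> < 1\<close>.\<close>

lemma scaled_powr:
  fixes \<beta> E a \<alpha> :: real
  assumes "\<beta> > 1" "E > 0"
  shows "a / E powr \<alpha> = (a / \<beta> ^ n) / (E / \<beta> ^ n) powr \<alpha> * (\<beta> powr (1 - \<alpha>)) ^ n"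
proof -
  have n: "\<beta> ^ n = \<beta> powr real n" using assms(1) by (simp add: powr_realpow)
  have "(\<beta> powr (1 - \<alpha>)) ^ n = (\<beta> powr (1 - \<alpha>)) powr real n"
    using assms(1) by (simp add: powr_realpow)
  also have "\<dots> = \<beta> powr (real n - real n * \<alpha>)" by (simp add: powr_powr algebra_simps)
  also have "\<dots> = \<beta> ^ n / (\<beta> ^ n) powr \<alpha>" unfolding n by (simp add: powr_diff powr_powr)
  finally have "(\<beta> powr (1 - \<alpha>)) ^ n = \<beta> ^ n / (\<beta> ^ n) powr \<alpha>" .
  moreover have "(E / \<beta> ^ n) powr \<alpha> = E powr \<alpha> / (\<beta> ^ n) powr \<alpha>"
    by (rule powr_divide)
  ultimately show ?thesis using assms by simp
qed

section \<open>The fixed point of the renormalization operator\<close>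

lemma (in kbonacci) sum_letter_counts:
  assumes "x \<in> seqs k"
  shows "(\<Sum>l<k. v l * real (count_list (map x [0..<m]) l)) = birkhoff (\<lambda>x. v (x 0)) m x"
proof (induction m)
  case (Suc m)
  have "x m < k" using assms by (simp add: seqs_def)
  have "(\<Sum>l<k. v l * real (count_list (map x [0..<Suc m]) l))
      = (\<Sum>l<k. v l * real (count_list (map x [0..<m]) l)) + (\<Sum>l<k. if l = x m then v l else 0)"
    unfolding sum.distrib[symmetric] by (intro sum.cong refl) (auto simp: algebra_simps)
  also have "(\<Sum>l<k. if l = x m then v l else 0) = v (x m)" using \<open>x m < k\<close> by simp
  finally show ?case using Suc by (simp add: birkhoff_Suc shift_seq_pow)
qed simp

context kbonacci_root
begin

text \<open>With \<open>m = delta k x\<close>, the summand \<open>\<beta> / (\<beta> - 1)\<close> accounts for the letters \<open>0\<close> that each substitution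
appends to the legal prefix; it makes \<open>total_weight\<close> exactly multiplicative under the substitution.\<close>

definition total_weight :: "(nat \<Rightarrow> nat) \<Rightarrow> nat \<Rightarrow> real" where
  "total_weight x m = \<beta> / (\<beta> - 1) + birkhoff weight m x"

lemma total_weight_gt:
  assumes "1 \<le> m"
  shows "real m < total_weight x m - weight x"
proof -
  have "birkhoff weight m x = weight x + birkhoff weight (m - 1) ((shift_seq ^^ 1) x)"
    using birkhoff_add[of weight 1 "m - 1" x] assms by simp
  moreover have "\<beta> / (\<beta> - 1) > 1" using beta_gt_1 by simp
  moreover have "real (m - 1) = real m - 1" using assms by (simp add: of_nat_diff)
  ultimately show ?thesis
    using birkhoff_weight_ge[of "m - 1" "(shift_seq ^^ 1) x"] unfolding total_weight_def by linarith
qed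

lemma total_weight_subst:
  assumes "x \<in> seqs k"
  shows "total_weight (subst_seq k x) (Suc (img_len k x m)) = \<beta> * total_weight x m"
proof -
  have "birkhoff weight (img_len k x m) (subst_seq k x) = birkhoff (\<lambda>x. \<beta> * weight x) m x"
    unfolding birkhoff_renorm[symmetric] by (rule birkhoff_cong[OF assms renorm_weight])
  also have "\<dots> = \<beta> * birkhoff weight m x" by (simp add: birkhoff_def sum_distrib_left)
  finally have "birkhoff weight (Suc (img_len k x m)) (subst_seq k x) = \<beta> * birkhoff weight m x + \<beta>"
    by (simp add: birkhoff_Suc shift_subst_seq letter_weight_0)
  thus ?thesis using beta_gt_1 by (simp add: total_weight_def field_simps)
qed

lemma total_weight_iterate:
  assumes "x \<in> seqs k"
  shows "total_weight ((subst_seq k ^^ n) x) (exit_iter x m n) = \<beta> ^ n * total_weight x m"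
  by (induction n) (simp_all add: total_weight_subst subst_pow_in_seqs assms)

definition fixed_potential :: "(nat \<Rightarrow> nat) \<Rightarrow> real" where
  "fixed_potential x = (case delta k x of
     enat m \<Rightarrow> ln (1 + weight x / (total_weight x m - weight x)) | \<infinity> \<Rightarrow> 0)"

lemma fixed_potential_in_space: "x \<in> subst_space k \<Longrightarrow> fixed_potential x = 0"
  by (simp add: fixed_potential_def delta_in_space)

text \<open>The form in which the values along a block telescope.\<close>

lemma fixed_potential_exits:
  assumes "exits_at m x" "1 \<le> m"
  shows "fixed_potential x = ln (total_weight x m / (total_weight x m - weight x))"
proof -
  have "total_weight x m - weight x > 0" using total_weight_gt[OF assms(2), of x] by linarith
  hence "1 + weight x / (total_weight x m - weight x) = total_weight x m / (total_weight x m - weight x)"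
    by (simp add: field_simps)
  thus ?thesis by (simp add: fixed_potential_def delta_exits_at[OF assms(1)])
qed

lemma fixed_potential_bounds:
  assumes "exits_at m x" "1 \<le> m"
  shows "0 \<le> fixed_potential x" "fixed_potential x \<le> \<beta> / real m"
proof -
  let ?d = "total_weight x m - weight x"
  have d: "?d \<ge> real m" using total_weight_gt[OF assms(2), of x] by simp
  have m: "real m > 0" using assms(2) by simp
  have U: "fixed_potential x = ln (1 + weight x / ?d)"
    by (simp add: fixed_potential_def delta_exits_at[OF assms(1)])
  have q: "weight x / ?d \<ge> 0" using d m letter_weight_pos[of "x 0"] by simp
  thus "0 \<le> fixed_potential x" unfolding U by simp
  have "fixed_potential x \<le> weight x / ?d" unfolding U using q by (rule ln_add_one_self_le_self)
  also have "\<dots> \<le> \<beta> / real m"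
    using d m letter_weight_le[of "x 0"] letter_weight_pos[of "x 0"] by (intro frac_le) auto
  finally show "fixed_potential x \<le> \<beta> / real m" .
qed

lemma fixed_potential_nonneg:
  assumes "x \<in> seqs k"
  shows "0 \<le> fixed_potential x"
proof (cases "x \<in> subst_space k")
  case False
  then obtain m where "exits_at m x" using exits_at_exists by blast
  thus ?thesis using fixed_potential_bounds(1) exits_at_pos[OF assms] by blast
qed (simp add: fixed_potential_in_space)

text \<open>With \<open>A = total_weight x m\<close>, the total weight is \<open>\<beta> A\<close> at \<open>s x\<close> and decreases along the block by the
weights of the letters passed, which add up to \<open>\<beta> weight x\<close>. The logarithms telescope to
\<open>ln (\<beta> A / (\<beta> A - \<beta> weight x))\<close>.\<close>

lemma renorm_fixed_potential:
  assumes x: "x \<in> seqs k"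
  shows "renorm k fixed_potential x = fixed_potential x"
proof (cases "x \<in> subst_space k")
  case True
  have "fixed_potential ((shift_seq ^^ j) (subst_seq k x)) = 0" for j
    by (intro fixed_potential_in_space subst_space_shift subst_space_subst True)
  thus ?thesis by (simp add: renorm_def fixed_potential_in_space True)
next
  case False
  then obtain m where m: "exits_at m x" using exits_at_exists by blast
  let ?s = "subst_seq k x" and ?m = "Suc (img_len k x m)"
  define A where "A = total_weight x m"
  have m1: "1 \<le> m" by (rule exits_at_pos[OF x m])
  have Aw: "A - weight x > 0" using total_weight_gt[OF m1, of x] by (simp add: A_def)
  have A: "A > 0" using Aw letter_weight_pos[of "x 0"] by linarith
  have total: "total_weight ?s ?m = \<beta> * A" unfolding A_def by (rule total_weight_subst[OF x])
  have "exits_at ?m ?s" using exits_at_subst[OF m, of 0] by (simp add: letter_len_eq)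
  hence U0: "fixed_potential ?s = ln (\<beta> * A / (\<beta> * A - \<beta>))"
    by (subst fixed_potential_exits) (auto simp: total letter_weight_0)
  have Ux: "fixed_potential x = ln (A / (A - weight x))"
    unfolding A_def by (rule fixed_potential_exits[OF m m1])
  show ?thesis
  proof (cases "x 0 = k - 1")
    case True
    hence "weight x = 1" by (simp only: letter_weight_last)
    moreover have "\<beta> * A / (\<beta> * A - \<beta>) = A / (A - 1)"
    proof -
      have "\<beta> * A - \<beta> = \<beta> * (A - 1)" by (simp add: algebra_simps)
      thus ?thesis using beta_gt_1 by simp
    qed
    ultimately show ?thesis using True by (simp add: renorm_eq U0 Ux)
  next
    case False
    have ex: "exits_at (img_len k x m) (shift_seq ?s)"
      using exits_at_subst[OF m, of 1] False by (simp add: letter_len_eq)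
    have "birkhoff weight ?m ?s = weight ?s + birkhoff weight (img_len k x m) (shift_seq ?s)"
      using birkhoff_add[of weight 1 "img_len k x m" ?s] by simp
    hence "total_weight (shift_seq ?s) (img_len k x m) = \<beta> * A - \<beta>"
      using total by (simp add: total_weight_def letter_weight_0)
    moreover have "1 \<le> img_len k x m" using img_len_ge[of m k x] m1 by simp
    ultimately have U1: "fixed_potential (shift_seq ?s)
        = ln ((\<beta> * A - \<beta>) / (\<beta> * A - \<beta> - \<beta> * (weight x - 1)))"
      using fixed_potential_exits[OF ex] weight_shift_subst[OF x False] by simp
    have w: "weight x \<ge> 1" by (rule letter_weight_ge_1)
    have A1: "A - 1 > 0" using Aw w by linarith
    have eq: "\<beta> * A - \<beta> = \<beta> * (A - 1)" "\<beta> * (A - 1) - \<beta> * (weight x - 1) = \<beta> * (A - weight x)"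
      by (simp_all add: algebra_simps)
    have "renorm k fixed_potential x = ln (\<beta> * A / (\<beta> * (A - 1))) + ln (\<beta> * (A - 1) / (\<beta> * (A - weight x)))"
      using False by (simp add: renorm_eq U0 U1 eq)
    also have "\<dots> = ln (A / (A - 1)) + ln ((A - 1) / (A - weight x))" using beta_gt_1 by simp
    also have "\<dots> = ln (A / (A - weight x))" using A A1 Aw by (simp add: ln_div)
    finally show ?thesis by (simp add: Ux)
  qed
qed

text \<open>Off the subshift the potential is locally constant; near it the exit time is large, and the potential
is at most \<open>\<beta> / m\<close>.\<close>

lemma continuous_fixed_potential: "continuous_on (seqs k) fixed_potential"
proof (rule continuous_on_agreeI)
  fix x and e :: real assume x: "x \<in> seqs k" and e: "e > 0"
  show "\<exists>n. \<forall>y\<in>seqs k. agree n x y \<longrightarrow> \<bar>fixed_potential y - fixed_potential x\<bar> < e"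
  proof (cases "x \<in> subst_space k")
    case True
    obtain n :: nat where n: "\<beta> / e < real n" using reals_Archimedean2 by blast
    have n0: "real n > 0" using n e beta_gt_1 by (smt (verit) divide_pos_pos)
    have "\<bar>fixed_potential y - fixed_potential x\<bar> < e" if y: "y \<in> seqs k" "agree n x y" for y
    proof (cases "y \<in> subst_space k")
      case False
      then obtain m where m: "exits_at m y" using exits_at_exists by blast
      have m1: "1 \<le> m" by (rule exits_at_pos[OF y(1) m])
      have "legal n y" using True y(2) legal_agree by (auto simp: subst_space_iff)
      hence "n \<le> m" using m legal_mono[of n y "Suc m"] unfolding exits_at_def by (meson not_less_eq_eq)
      hence "\<beta> / real m \<le> \<beta> / real n" using n0 beta_gt_1 by (intro divide_left_mono) auto
      also have "\<dots> < e" using n n0 e by (simp add: field_simps)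
      finally show ?thesis using fixed_potential_bounds[OF m m1] True
        by (simp add: fixed_potential_in_space)
    qed (use e True in \<open>simp add: fixed_potential_in_space\<close>)
    thus ?thesis by blast
  next
    case False
    then obtain m where m: "exits_at m x" using exits_at_exists by blast
    have "fixed_potential y = fixed_potential x" if y: "agree (Suc m) x y" for y
    proof -
      have "legal m y" using m legal_agree[OF _ agree_mono[OF y]] by (simp add: exits_at_def)
      moreover have "\<not> legal (Suc m) y"
        using m legal_agree[OF _ agree_sym[OF y]] by (auto simp: exits_at_def)
      ultimately have "exits_at m y" by (simp add: exits_at_def)
      moreover have "x 0 = y 0" using y by (simp add: agree_def)
      moreover have "birkhoff weight m x = birkhoff weight m y"
        using y unfolding birkhoff_def by (intro sum.cong) (auto simp: agree_def shift_seq_pow)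
      ultimately show ?thesis using m
        by (simp add: fixed_potential_def delta_exits_at total_weight_def)
    qed
    thus ?thesis using e by (intro exI[of _ "Suc m"]) auto
  qed
qed

end

section \<open>Convergence of the iterates\<close>

locale kbonacci_exit = kbonacci_root +
  fixes x :: "nat \<Rightarrow> nat" and m :: nat
  assumes x_in_seqs: "x \<in> seqs k" and x_exits: "exits_at m x"
begin

abbreviation block :: "nat \<Rightarrow> nat" where
  "block n \<equiv> iter_len k n x 1"

abbreviation exit_time :: "nat \<Rightarrow> nat" where
  "exit_time n \<equiv> exit_iter x m n"

abbreviation point :: "nat \<Rightarrow> nat \<Rightarrow> nat \<Rightarrow> nat" where
  "point n j \<equiv> (shift_seq ^^ j) ((subst_seq k ^^ n) x)"

abbreviation A :: real where
  "A \<equiv> total_weight x m"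

lemma m_pos: "1 \<le> m"
  by (rule exits_at_pos[OF x_in_seqs x_exits])

lemma A_gt: "A - weight x > 0"
  using total_weight_gt[OF m_pos, of x] by linarith

lemma point_in_seqs: "point n j \<in> seqs k"
  by (intro shift_seq_in_seqs subst_pow_in_seqs x_in_seqs)

lemma point_exits: "j < block n \<Longrightarrow> exits_at (exit_time n - j) (point n j)"
  using exits_at_iterate[OF x_in_seqs x_exits, of n] by blast

lemma block_le_exit: "block n \<le> exit_time n"
  using exits_at_iterate[OF x_in_seqs x_exits, of n] by blast

lemma inv_delta_point:
  "j < block n \<Longrightarrow> inv_delta_powr k \<alpha> (point n j) = 1 / real (exit_time n - j) powr \<alpha>"
  by (simp add: inv_delta_powr_def delta_exits_at[OF point_exits])

lemma renorm_pow_sum: "(renorm k ^^ n) V x = (\<Sum>j<block n. V (point n j))"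
  by (simp add: renorm_pow_eq_birkhoff birkhoff_def)

lemma null_mean_birkhoff_orbit:
  assumes "null_mean f" "\<epsilon> > 0"
  obtains q K where "K \<ge> 0"
    "\<And>n N. n \<ge> q \<Longrightarrow> \<bar>birkhoff f N ((subst_seq k ^^ n) x)\<bar> \<le> \<epsilon> * real N + K"
proof (rule null_mean_birkhoff[OF assms])
  fix q K
  assume K: "K \<ge> 0"
    "\<And>z N. z \<in> seqs k \<Longrightarrow> \<bar>birkhoff f N ((subst_seq k ^^ q) z)\<bar> \<le> \<epsilon> * real N + K"
  have "\<bar>birkhoff f N ((subst_seq k ^^ n) x)\<bar> \<le> \<epsilon> * real N + K" if "n \<ge> q" for n N
  proof -
    have "(subst_seq k ^^ n) x = (subst_seq k ^^ q) ((subst_seq k ^^ (n - q)) x)"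
      using that funpow_add[of q "n - q" "subst_seq k"] by simp
    thus ?thesis using K(2)[OF subst_pow_in_seqs[OF x_in_seqs]] by simp
  qed
  thus thesis using that K(1) by blast
qed

lemma beta_pow_at_top: "filterlim (\<lambda>n. \<beta> ^ n) at_top sequentially"
  using beta_gt_1 by (rule power_at_top)

text \<open>Weights are known exactly along the iterates; since \<open>1 - c * weight\<close> has mean zero, lengths are
asymptotically \<open>c\<close> times weights.\<close>

lemma length_from_weight:
  assumes c: "null_mean (\<lambda>x. 1 - c * weight x)" "c > 0"
    and P: "\<And>n. birkhoff weight (P n) ((subst_seq k ^^ n) x) = \<beta> ^ n * a - b"
    and "b \<ge> 0" "a > 0"
  shows "(\<lambda>n. real (P n) / \<beta> ^ n) \<longlonglongrightarrow> c * a"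
proof (rule LIMSEQ_I)
  fix r :: real assume r: "r > 0"
  define \<epsilon> where "\<epsilon> = r / (2 * a)"
  have \<epsilon>: "\<epsilon> > 0" using r assms(5) by (simp add: \<epsilon>_def)
  obtain q K where K: "K \<ge> 0" "\<And>n N. n \<ge> q \<Longrightarrow>
      \<bar>birkhoff (\<lambda>x. 1 - c * weight x) N ((subst_seq k ^^ n) x)\<bar> \<le> \<epsilon> * real N + K"
    by (rule null_mean_birkhoff_orbit[OF c(1) \<epsilon>]) blast
  obtain n0 where n0: "\<And>n. n \<ge> n0 \<Longrightarrow> 2 * (K + c * b) / r + 1 \<le> \<beta> ^ n"
    using eventually_beta_pow_ge by blast
  have "norm (real (P n) / \<beta> ^ n - c * a) < r" if n: "n \<ge> max q n0" for n
  proof -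
    have pos: "\<beta> ^ n > 0" using beta_gt_1 by simp
    have "birkhoff (\<lambda>x. 1 - c * weight x) (P n) ((subst_seq k ^^ n) x) = real (P n) - c * (\<beta> ^ n * a - b)"
      by (simp only: birkhoff_diff P birkhoff_const mult_1_right)
    hence "\<bar>real (P n) - c * (\<beta> ^ n * a - b)\<bar> \<le> \<epsilon> * real (P n) + K"
      using K(2)[of n "P n"] n by simp
    moreover have "\<epsilon> * real (P n) \<le> \<epsilon> * (\<beta> ^ n * a)"
      using birkhoff_weight_ge[of "P n" "(subst_seq k ^^ n) x"] \<epsilon> \<open>b \<ge> 0\<close> unfolding P
      by (intro mult_left_mono) auto
    moreover have "\<epsilon> * (\<beta> ^ n * a) = r / 2 * \<beta> ^ n" using assms(5) by (simp add: \<epsilon>_def)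
    moreover have "c * (\<beta> ^ n * a - b) = c * a * \<beta> ^ n - c * b" by (simp add: algebra_simps)
    moreover have "K + c * b < r / 2 * \<beta> ^ n"
    proof -
      have "2 * (K + c * b) / r < \<beta> ^ n" using n0[of n] n by simp
      thus ?thesis using r by (simp add: field_simps)
    qed
    moreover have "c * b \<ge> 0" using c(2) \<open>b \<ge> 0\<close> by simp
    ultimately have "\<bar>real (P n) - c * a * \<beta> ^ n\<bar> < r * \<beta> ^ n" by linarith
    moreover have "real (P n) / \<beta> ^ n - c * a = (real (P n) - c * a * \<beta> ^ n) / \<beta> ^ n"
      using beta_gt_1 by (simp add: diff_divide_distrib)
    ultimately show ?thesis using pos by (simp add: pos_divide_less_eq)
  qed
  thus "\<exists>no. \<forall>n\<ge>no. norm (real (P n) / \<beta> ^ n - c * a) < r" by blast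
qed

text \<open>The block has weight \<open>\<beta>\<^sup>n * weight x\<close>, and the legal prefix of \<open>s\<^sup>n x\<close> has weight
\<open>\<beta>\<^sup>n * A - \<beta> / (\<beta> - 1)\<close>.\<close>

lemma growth:
  obtains c where "c > 0" "(\<lambda>n. real (block n) / \<beta> ^ n) \<longlonglongrightarrow> c * weight x"
    "(\<lambda>n. real (exit_time n) / \<beta> ^ n) \<longlonglongrightarrow> c * A"
    "(\<lambda>n. real (exit_time n - block n) / \<beta> ^ n) \<longlonglongrightarrow> c * (A - weight x)"
proof -
  obtain c where c: "c > 0" "null_mean (\<lambda>x. 1 - c * weight x)" using block_length_asymptotics by blast
  have 1: "(\<lambda>n. real (block n) / \<beta> ^ n) \<longlonglongrightarrow> c * weight x"
    by (rule length_from_weight[OF c(2,1), where b = 0])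
       (simp_all add: birkhoff_weight_iterate[OF x_in_seqs] letter_weight_pos del: One_nat_def, simp)
  have 2: "(\<lambda>n. real (exit_time n) / \<beta> ^ n) \<longlonglongrightarrow> c * A"
  proof (rule length_from_weight[OF c(2,1), where b = "\<beta> / (\<beta> - 1)"])
    show "birkhoff weight (exit_time n) ((subst_seq k ^^ n) x) = \<beta> ^ n * A - \<beta> / (\<beta> - 1)" for n
      using total_weight_iterate[OF x_in_seqs, of n m] by (simp add: total_weight_def)
    show "0 \<le> \<beta> / (\<beta> - 1)" using beta_gt_1 by simp
    show "0 < A" using A_gt letter_weight_pos[of "x 0"] by linarith
  qed
  have "(\<lambda>n. real (exit_time n) / \<beta> ^ n - real (block n) / \<beta> ^ n) \<longlonglongrightarrow> c * A - c * weight x"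
    by (intro tendsto_diff 1 2)
  hence "(\<lambda>n. real (exit_time n - block n) / \<beta> ^ n) \<longlonglongrightarrow> c * (A - weight x)"
    using block_le_exit by (simp add: of_nat_diff diff_divide_distrib right_diff_distrib)
  thus ?thesis using that c(1) 1 2 by blast
qed

lemma gap_at_top: "filterlim (\<lambda>n. real (exit_time n - block n)) at_top sequentially"
proof -
  obtain c where c: "c > 0"
    "(\<lambda>n. real (exit_time n - block n) / \<beta> ^ n) \<longlonglongrightarrow> c * (A - weight x)"
    using growth by blast
  have "filterlim (\<lambda>n. real (exit_time n - block n) / \<beta> ^ n * \<beta> ^ n) at_top sequentially"
    using c A_gt by (intro filterlim_tendsto_pos_mult_at_top[OF c(2) _ beta_pow_at_top]) auto
  thus ?thesis using beta_gt_1 by simp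
qed

lemma eventually_gap_ge: "eventually (\<lambda>n. p \<le> exit_time n - block n) sequentially"
  using gap_at_top unfolding filterlim_at_top by (auto elim!: allE[of _ "real p"])

text \<open>The points of the block stay at a distance at least \<open>exit_time n - block n\<close> from their exit, so
they approach the subshift uniformly.\<close>

lemma eventually_small_near_space:
  fixes h :: "(nat \<Rightarrow> nat) \<Rightarrow> real"
  assumes h: "continuous_on (seqs k) h" "\<forall>y\<in>subst_space k. h y = 0" and "\<epsilon> > 0"
  shows "eventually (\<lambda>n. \<forall>j<block n. \<bar>h (point n j)\<bar> < \<epsilon>) sequentially"
proof -
  obtain p where p: "\<And>x y. x \<in> seqs k \<Longrightarrow> y \<in> seqs k \<Longrightarrow> agree p x y \<Longrightarrow> \<bar>h x - h y\<bar> < \<epsilon>"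
    using uniformly_continuous_agree[OF h(1) assms(3)] by blast
  show ?thesis
    using eventually_gap_ge[of p]
  proof eventually_elim
    case (elim n)
    show ?case
    proof safe
      fix j assume j: "j < block n"
      have "legal p (point n j)"
        using point_exits[OF j] legal_mono elim j unfolding exits_at_def
        by (meson diff_le_mono2 le_trans less_imp_le)
      then obtain M where M: "agree p (point n j) ((shift_seq ^^ M) (omega k))"
        by (auto simp: legal_def)
      have "omega k \<in> subst_space k"
        unfolding subst_space_iff legal_def by (auto simp: agree_def intro: exI[of _ 0])
      hence "(shift_seq ^^ M) (omega k) \<in> subst_space k" by (rule subst_space_shift)
      thus "\<bar>h (point n j)\<bar> < \<epsilon>"
        using p[OF point_in_seqs _ M] h(2) subst_space_subset by force
    qed
  qed
qed

lemma point_factor_bounds: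
  assumes "j < block n" "block n < exit_time n" "\<alpha> > 0"
  shows "1 / real (exit_time n) powr \<alpha> \<le> 1 / real (exit_time n - j) powr \<alpha>"
    "1 / real (exit_time n - j) powr \<alpha> \<le> 1 / real (exit_time n - block n) powr \<alpha>"
  using assms by (auto intro!: divide_left_mono powr_mono2 mult_pos_pos simp: of_nat_diff)

text \<open>There are about \<open>\<beta>\<^sup>n\<close> terms, each of order at most
\<open>\<beta> powr (- n * \<alpha>)\<close>.\<close>

lemma limit_fast_decay:
  fixes V f :: "(nat \<Rightarrow> nat) \<Rightarrow> real"
  assumes V: "\<forall>y\<in>seqs k. 0 \<le> V y"
    "\<forall>y\<in>seqs k. V y = f y * inv_delta_powr k \<alpha> y"
    and f: "continuous_on (seqs k) f" and \<alpha>: "\<alpha> > 1"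
  shows "(\<lambda>n. (renorm k ^^ n) V x) \<longlonglongrightarrow> 0"
proof -
  obtain C where C: "C > 0" "\<And>y. y \<in> seqs k \<Longrightarrow> \<bar>f y\<bar> \<le> C" using bounded_on_seqs[OF f] by blast
  obtain c where c: "c > 0" "(\<lambda>n. real (block n) / \<beta> ^ n) \<longlonglongrightarrow> c * weight x"
    "(\<lambda>n. real (exit_time n - block n) / \<beta> ^ n) \<longlonglongrightarrow> c * (A - weight x)"
    using growth by blast
  let ?E = "\<lambda>n. real (exit_time n - block n)"
  let ?b = "\<lambda>n. C * (real (block n) / \<beta> ^ n / (?E n / \<beta> ^ n) powr \<alpha> * (\<beta> powr (1 - \<alpha>)) ^ n)"
  have "\<beta> powr (1 - \<alpha>) < \<beta> powr 0" using beta_gt_1 \<alpha> by (intro powr_less_mono) auto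
  hence pow: "(\<lambda>n. (\<beta> powr (1 - \<alpha>)) ^ n) \<longlonglongrightarrow> 0"
    using beta_gt_1 by (intro LIMSEQ_realpow_zero) auto
  have "(\<lambda>n. real (block n) / \<beta> ^ n / (?E n / \<beta> ^ n) powr \<alpha>)
      \<longlonglongrightarrow> c * weight x / (c * (A - weight x)) powr \<alpha>"
    using c A_gt by (intro tendsto_intros) auto
  from tendsto_mult_left[OF tendsto_mult[OF this pow], of C] have lim: "?b \<longlonglongrightarrow> 0" by simp
  have "eventually (\<lambda>n. (renorm k ^^ n) V x \<le> ?b n) sequentially"
    using eventually_gap_ge[of 1]
  proof eventually_elim
    case (elim n)
    have "(renorm k ^^ n) V x \<le> (\<Sum>j<block n. C * (1 / ?E n powr \<alpha>))"
      unfolding renorm_pow_sum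
    proof (rule sum_mono)
      fix j assume "j \<in> {..<block n}"
      hence j: "j < block n" by simp
      have "V (point n j) = f (point n j) * (1 / real (exit_time n - j) powr \<alpha>)"
        using bspec[OF V(2) point_in_seqs[of j n]] inv_delta_point[OF j] by simp
      also have "\<dots> \<le> C * (1 / ?E n powr \<alpha>)"
        using point_factor_bounds(2)[OF j, of \<alpha>] elim \<alpha> C(1) C(2)[OF point_in_seqs[of j n]]
        by (intro mult_mono) auto
      finally show "V (point n j) \<le> C * (1 / ?E n powr \<alpha>)" .
    qed
    also have "\<dots> = C * (real (block n) / ?E n powr \<alpha>)" by simp
    also have "real (block n) / ?E n powr \<alpha>
        = real (block n) / \<beta> ^ n / (?E n / \<beta> ^ n) powr \<alpha> * (\<beta> powr (1 - \<alpha>)) ^ n"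
      using elim beta_gt_1 by (intro scaled_powr) auto
    finally show ?case .
  qed
  hence upper: "eventually (\<lambda>n. (renorm k ^^ n) V x \<le> ?b n) sequentially" .
  have "0 \<le> (renorm k ^^ n) V x" for n
    unfolding renorm_pow_sum by (intro sum_nonneg bspec[OF V(1)] point_in_seqs)
  hence "eventually (\<lambda>n. 0 \<le> (renorm k ^^ n) V x) sequentially" by (rule always_eventually[OF allI])
  thus ?thesis by (rule real_tendsto_sandwich[OF _ upper tendsto_const lim])
qed

text \<open>Since \<open>g\<close> is bounded below by \<open>2 \<gamma> > 0\<close> on the compact space and \<open>h\<close> becomes smaller than \<open>\<gamma>\<close>,
each of the about \<open>\<beta>\<^sup>n\<close> terms is at least of order \<open>\<beta> powr (- n * \<alpha>)\<close>.\<close>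

lemma limit_slow_decay:
  fixes V g h :: "(nat \<Rightarrow> nat) \<Rightarrow> real"
  assumes V: "\<forall>y\<in>seqs k. V y = g y * inv_delta_powr k \<alpha> y + h y * inv_delta_powr k \<alpha> y"
    and g: "continuous_on (seqs k) g" "\<forall>y\<in>seqs k. 0 < g y"
    and h: "continuous_on (seqs k) h" "\<forall>y\<in>subst_space k. h y = 0"
    and \<alpha>: "0 < \<alpha>" "\<alpha> < 1"
  shows "filterlim (\<lambda>n. (renorm k ^^ n) V x) at_top sequentially"
proof -
  have "seqs k \<noteq> {}" using x_in_seqs by blast
  then obtain y0 where y0: "y0 \<in> seqs k" "\<And>y. y \<in> seqs k \<Longrightarrow> g y0 \<le> g y"
    using continuous_attains_inf[OF compact_seqs _ g(1)] by blast
  define \<gamma> where "\<gamma> = g y0 / 2"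
  have \<gamma>: "\<gamma> > 0" using bspec[OF g(2) y0(1)] by (simp add: \<gamma>_def)
  obtain c where c: "c > 0" "(\<lambda>n. real (block n) / \<beta> ^ n) \<longlonglongrightarrow> c * weight x"
    "(\<lambda>n. real (exit_time n) / \<beta> ^ n) \<longlonglongrightarrow> c * A"
    using growth by blast
  let ?D = "\<lambda>n. real (exit_time n)"
  have A: "A > 0" using A_gt letter_weight_pos[of "x 0"] by linarith
  have "\<beta> powr 0 < \<beta> powr (1 - \<alpha>)" using beta_gt_1 \<alpha> by (intro powr_less_mono) auto
  hence pow: "filterlim (\<lambda>n. (\<beta> powr (1 - \<alpha>)) ^ n) at_top sequentially"
    using beta_gt_1 by (intro power_at_top) simp
  have coeff: "(\<lambda>n. \<gamma> * (real (block n) / \<beta> ^ n / (?D n / \<beta> ^ n) powr \<alpha>))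
      \<longlonglongrightarrow> \<gamma> * (c * weight x / (c * A) powr \<alpha>)"
    using c A by (intro tendsto_intros) auto
  have lim: "filterlim (\<lambda>n. \<gamma> * (real (block n) / \<beta> ^ n / (?D n / \<beta> ^ n) powr \<alpha>)
      * (\<beta> powr (1 - \<alpha>)) ^ n) at_top sequentially"
    by (rule filterlim_tendsto_pos_mult_at_top[OF coeff _ pow])
      (intro mult_pos_pos divide_pos_pos \<gamma> c(1) letter_weight_pos, use c(1) A in simp)
  have "eventually (\<lambda>n. \<gamma> * (real (block n) / \<beta> ^ n / (?D n / \<beta> ^ n) powr \<alpha>)
      * (\<beta> powr (1 - \<alpha>)) ^ n \<le> (renorm k ^^ n) V x) sequentially"
    using eventually_gap_ge[of 1] eventually_small_near_space[OF h \<gamma>]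
  proof eventually_elim
    case (elim n)
    have "\<gamma> * (real (block n) / \<beta> ^ n / (?D n / \<beta> ^ n) powr \<alpha>) * (\<beta> powr (1 - \<alpha>)) ^ n
        = \<gamma> * (real (block n) / \<beta> ^ n / (?D n / \<beta> ^ n) powr \<alpha> * (\<beta> powr (1 - \<alpha>)) ^ n)"
      by (simp only: mult.assoc)
    also have "real (block n) / \<beta> ^ n / (?D n / \<beta> ^ n) powr \<alpha> * (\<beta> powr (1 - \<alpha>)) ^ n
        = real (block n) / ?D n powr \<alpha>"
      using elim(1) beta_gt_1 by (intro scaled_powr[symmetric]) auto
    also have "\<gamma> * \<dots> = (\<Sum>j<block n. \<gamma> * (1 / ?D n powr \<alpha>))" by simp
    also have "\<dots> \<le> (renorm k ^^ n) V x"
      unfolding renorm_pow_sum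
    proof (rule sum_mono)
      fix j assume "j \<in> {..<block n}"
      hence j: "j < block n" by simp
      have "2 * \<gamma> \<le> g (point n j)" using y0(2)[OF point_in_seqs] by (simp add: \<gamma>_def)
      moreover have "\<bar>h (point n j)\<bar> < \<gamma>" using elim(2) j by blast
      ultimately have "\<gamma> \<le> g (point n j) + h (point n j)" by linarith
      hence "\<gamma> * (1 / ?D n powr \<alpha>)
          \<le> (g (point n j) + h (point n j)) * (1 / real (exit_time n - j) powr \<alpha>)"
        using point_factor_bounds(1)[OF j, of \<alpha>] elim(1) \<alpha>(1) \<gamma> by (intro mult_mono) auto
      also have "\<dots> = V (point n j)"
        unfolding bspec[OF V point_in_seqs[of j n]] inv_delta_point[OF j] by (rule distrib_right)
      finally show "\<gamma> * (1 / ?D n powr \<alpha>) \<le> V (point n j)" .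
    qed
    finally show ?case .
  qed
  thus ?thesis by (rule filterlim_at_top_mono[OF lim])
qed

text \<open>A harmonic sum from \<open>exit_time n - block n\<close> to \<open>exit_time n\<close>, whose endpoints have the limit ratio
\<open>(A - weight x) / A\<close>.\<close>

lemma harmonic_limit:
  "(\<lambda>n. \<Sum>j<block n. 1 / real (exit_time n - j)) \<longlonglongrightarrow> fixed_potential x"
proof -
  obtain c where c: "c > 0" "(\<lambda>n. real (block n) / \<beta> ^ n) \<longlonglongrightarrow> c * weight x"
    "(\<lambda>n. real (exit_time n) / \<beta> ^ n) \<longlonglongrightarrow> c * A"
    using growth by blast
  let ?N = "\<lambda>n. real (block n)" and ?D = "\<lambda>n. real (exit_time n)"
  have scale: "(a / \<beta> ^ n) / (b / \<beta> ^ n) = a / b" for a b n using beta_gt_1 by simp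
  have A: "A > 0" using A_gt letter_weight_pos[of "x 0"] by linarith
  have cA: "c * A - c * weight x > 0" using c(1) A_gt by (simp add: right_diff_distrib[symmetric])
  have val: "fixed_potential x = ln (c * A / (c * A - c * weight x))"
    using fixed_potential_exits[OF x_exits m_pos] c(1) by (simp add: right_diff_distrib[symmetric])
  have inv: "(\<lambda>n. 1 / \<beta> ^ n) \<longlonglongrightarrow> 0"
    using LIMSEQ_inverse_realpow_zero[OF beta_gt_1] by (simp add: inverse_eq_divide)
  have "(\<lambda>n. ln ((?D n / \<beta> ^ n) / (?D n / \<beta> ^ n - ?N n / \<beta> ^ n))) \<longlonglongrightarrow> fixed_potential x"
    unfolding val using c cA A by (intro tendsto_intros) auto
  hence upper: "(\<lambda>n. ln (?D n / (?D n - ?N n))) \<longlonglongrightarrow> fixed_potential x"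
    by (simp only: diff_divide_distrib[symmetric] scale)
  have "(\<lambda>n. ln ((?D n / \<beta> ^ n + 1 / \<beta> ^ n) / (?D n / \<beta> ^ n + 1 / \<beta> ^ n - ?N n / \<beta> ^ n)))
      \<longlonglongrightarrow> ln ((c * A + 0) / (c * A + 0 - c * weight x))"
    using c cA A by (intro tendsto_intros inv) auto
  hence lower: "(\<lambda>n. ln ((?D n + 1) / (?D n + 1 - ?N n))) \<longlonglongrightarrow> fixed_potential x"
    by (simp only: diff_divide_distrib[symmetric] add_divide_distrib[symmetric] scale val add_0_right)
  show ?thesis
    by (rule real_tendsto_sandwich[OF _ _ lower upper]; rule eventually_mono[OF eventually_gap_ge[of 1]])
       (rule harmonic_block_bounds, simp)+
qed

lemma gap_ratio_bounded:
  obtains B where "eventually (\<lambda>n. real (block n) / real (exit_time n - block n) \<le> B) sequentially"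
proof -
  obtain c where c: "c > 0" "(\<lambda>n. real (block n) / \<beta> ^ n) \<longlonglongrightarrow> c * weight x"
    "(\<lambda>n. real (exit_time n - block n) / \<beta> ^ n) \<longlonglongrightarrow> c * (A - weight x)"
    using growth by blast
  have scale: "(a / \<beta> ^ n) / (b / \<beta> ^ n) = a / b" for a b n using beta_gt_1 by simp
  have "(\<lambda>n. (real (block n) / \<beta> ^ n) / (real (exit_time n - block n) / \<beta> ^ n))
      \<longlonglongrightarrow> c * weight x / (c * (A - weight x))"
    using c A_gt by (intro tendsto_intros) auto
  hence "(\<lambda>n. real (block n) / real (exit_time n - block n)) \<longlonglongrightarrow> c * weight x / (c * (A - weight x))"
    by (simp only: scale)
  from order_tendstoD(2)[OF this, of "c * weight x / (c * (A - weight x)) + 1"]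
  show ?thesis by (intro that[of "c * weight x / (c * (A - weight x)) + 1"]) (auto elim: eventually_mono)
qed

text \<open>Partial sums are \<open>o(\<beta>\<^sup>n)\<close> and the largest factor is of order \<open>1 / \<beta>\<^sup>n\<close>, so
summation by parts applies.\<close>

lemma null_mean_sum_limit:
  assumes f: "null_mean f"
  shows "(\<lambda>n. \<Sum>j<block n. f (point n j) * (1 / real (exit_time n - j))) \<longlonglongrightarrow> 0"
proof (rule LIMSEQ_I)
  fix r :: real assume r: "r > 0"
  obtain B where B: "eventually (\<lambda>n. real (block n) / real (exit_time n - block n) \<le> B) sequentially"
    using gap_ratio_bounded by blast
  (* the sum is at most 2 (\<epsilon> N + K) / (D - N), where N / (D - N) is bounded by B *)
  define \<epsilon> where "\<epsilon> = r / (4 * (\<bar>B\<bar> + 1))"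
  have \<epsilon>: "\<epsilon> > 0" using r by (simp add: \<epsilon>_def)
  obtain q K where K: "K \<ge> 0"
    "\<And>n N. n \<ge> q \<Longrightarrow> \<bar>birkhoff f N ((subst_seq k ^^ n) x)\<bar> \<le> \<epsilon> * real N + K"
    by (rule null_mean_birkhoff_orbit[OF f \<epsilon>]) blast
  obtain p :: nat where p: "4 * K / r < real p" using reals_Archimedean2 by blast
  have "eventually (\<lambda>n. norm ((\<Sum>j<block n. f (point n j) * (1 / real (exit_time n - j))) - 0) < r) sequentially"
    using B eventually_gap_ge[of "Suc p"] eventually_ge_at_top[of q]
  proof eventually_elim
    case (elim n)
    let ?E = "real (exit_time n - block n)"
    have E: "?E > 0" "real p < ?E" using elim(2) by auto
    have "\<bar>\<Sum>j<block n. f (point n j) * (1 / real (exit_time n - j))\<bar>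
        \<le> 2 * (\<epsilon> * real (block n) + K) * (1 / ?E)"
    proof (rule abs_weighted_sum_le)
      fix i assume "i \<le> block n"
      hence "\<epsilon> * real i \<le> \<epsilon> * real (block n)" using \<epsilon> by (intro mult_left_mono) auto
      thus "\<bar>\<Sum>j<i. f (point n j)\<bar> \<le> \<epsilon> * real (block n) + K"
        using K(2)[OF elim(3), of i] unfolding birkhoff_def by linarith
    next
      fix j assume "j < block n"
      thus "1 / real (exit_time n - j) \<le> 1 / real (exit_time n - Suc j)"
        using E(1) by (intro divide_left_mono mult_pos_pos) auto
    qed simp
    also have "\<dots> = 2 * \<epsilon> * (real (block n) / ?E) + 2 * K / ?E"
      by (simp add: add_divide_distrib algebra_simps)
    also have "2 * \<epsilon> * (real (block n) / ?E) \<le> 2 * \<epsilon> * (\<bar>B\<bar> + 1)"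
    proof (rule mult_left_mono)
      show "real (block n) / ?E \<le> \<bar>B\<bar> + 1" 
        using order.trans[OF elim(1), of "\<bar>B\<bar> + 1"] by linarith
    qed (use \<epsilon> in simp)
    also have "2 * \<epsilon> * (\<bar>B\<bar> + 1) = r / 2" unfolding \<epsilon>_def by (simp add: field_simps)
    also have "2 * K / ?E < r / 2"
    proof -
      have "4 * K / r < ?E" using p E(2) by linarith
      thus ?thesis using r E(1) by (simp add: field_simps)
    qed
    finally show ?case by simp
  qed
  thus "\<exists>no. \<forall>n\<ge>no. norm ((\<Sum>j<block n. f (point n j) * (1 / real (exit_time n - j))) - 0) < r"
    by (simp add: eventually_sequentially)
qed

lemma vanishing_sum_limit:
  fixes h :: "(nat \<Rightarrow> nat) \<Rightarrow> real"
  assumes h: "continuous_on (seqs k) h" "\<forall>y\<in>subst_space k. h y = 0"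
  shows "(\<lambda>n. \<Sum>j<block n. h (point n j) * (1 / real (exit_time n - j))) \<longlonglongrightarrow> 0"
proof (rule LIMSEQ_I)
  fix r :: real assume r: "r > 0"
  define u where "u = \<bar>fixed_potential x\<bar> + 1"
  have u: "u > 0" by (simp add: u_def)
  have e: "r / u > 0" using r u by simp
  have bound: "eventually (\<lambda>n. (\<Sum>j<block n. 1 / real (exit_time n - j)) < u) sequentially"
    by (rule order_tendstoD(2)[OF harmonic_limit]) (simp add: u_def)
  have "eventually (\<lambda>n. norm ((\<Sum>j<block n. h (point n j) * (1 / real (exit_time n - j))) - 0) < r) sequentially"
    using bound eventually_small_near_space[OF h e]
  proof eventually_elim
    case (elim n)
    have "\<bar>\<Sum>j<block n. h (point n j) * (1 / real (exit_time n - j))\<bar>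
        \<le> (\<Sum>j<block n. r / u * (1 / real (exit_time n - j)))"
    proof (rule order.trans[OF sum_abs sum_mono])
      fix j assume "j \<in> {..<block n}"
      hence "\<bar>h (point n j)\<bar> \<le> r / u" using elim(2) by (auto intro: less_imp_le)
      thus "\<bar>h (point n j) * (1 / real (exit_time n - j))\<bar> \<le> r / u * (1 / real (exit_time n - j))"
        unfolding abs_mult using e by (intro mult_mono) auto
    qed
    also have "\<dots> = r / u * (\<Sum>j<block n. 1 / real (exit_time n - j))" by (simp only: sum_distrib_left)
    also have "\<dots> < r / u * u" using elim(1) e by (rule mult_strict_left_mono)
    also have "\<dots> = r" using u by simp
    finally show ?case by simp
  qed
  thus "\<exists>no. \<forall>n\<ge>no. norm ((\<Sum>j<block n. h (point n j) * (1 / real (exit_time n - j))) - 0) < r"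
    by (simp add: eventually_sequentially)
qed

text \<open>Split \<open>g + h\<close> into the mean \<open>a\<close> of \<open>g\<close>, which yields the harmonic sum, and the two parts \<open>g - a\<close>
and \<open>h\<close>, which contribute nothing in the limit.\<close>

lemma limit_critical_decay:
  fixes V g h :: "(nat \<Rightarrow> nat) \<Rightarrow> real"
  assumes V: "\<forall>y\<in>seqs k. V y = g y * inv_delta_powr k 1 y + h y * inv_delta_powr k 1 y"
    and g: "continuous_on (seqs k) g"
    and h: "continuous_on (seqs k) h" "\<forall>y\<in>subst_space k. h y = 0"
    and \<mu>: "ergodic_prob_on (subst_space k) shift_seq \<mu>"
  shows "(\<lambda>n. (renorm k ^^ n) V x) \<longlonglongrightarrow> (\<integral>y. g y \<partial>\<mu>) * fixed_potential x"
proof -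
  obtain a where a: "null_mean (\<lambda>y. g y - a)" using null_mean_exists[OF g] by blast
  interpret prob_space \<mu> using \<mu> by (simp add: ergodic_prob_on_def)
  have "has_bochner_integral \<mu> (\<lambda>y. (g y - a) + a) (0 + a)"
    using has_bochner_integral_add[OF integral_null_mean[OF a \<mu>], of "\<lambda>_. a" a]
    by (simp add: has_bochner_integral_iff prob_space)
  hence int: "(\<integral>y. g y \<partial>\<mu>) = a" by (simp add: has_bochner_integral_iff)
  have "(renorm k ^^ n) V x = (\<Sum>j<block n. (g (point n j) - a) * (1 / real (exit_time n - j)))
      + (\<Sum>j<block n. h (point n j) * (1 / real (exit_time n - j)))
      + a * (\<Sum>j<block n. 1 / real (exit_time n - j))" for n
    unfolding renorm_pow_sum sum_distrib_left sum.distrib[symmetric]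
  proof (rule sum.cong[OF refl])
    fix j assume "j \<in> {..<block n}"
    hence "inv_delta_powr k 1 (point n j) = 1 / real (exit_time n - j)"
      using inv_delta_point[of j n 1] by simp
    thus "V (point n j) = (g (point n j) - a) * (1 / real (exit_time n - j))
        + h (point n j) * (1 / real (exit_time n - j)) + a * (1 / real (exit_time n - j))"
      using bspec[OF V point_in_seqs[of j n]] by (simp only: left_diff_distrib) simp
  qed
  moreover have "(\<lambda>n. (\<Sum>j<block n. (g (point n j) - a) * (1 / real (exit_time n - j)))
      + (\<Sum>j<block n. h (point n j) * (1 / real (exit_time n - j)))
      + a * (\<Sum>j<block n. 1 / real (exit_time n - j))) \<longlonglongrightarrow> 0 + 0 + a * fixed_potential x"
    by (intro tendsto_add tendsto_mult_left null_mean_sum_limit[OF a] vanishing_sum_limit[OF h] harmonic_limit)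
  ultimately show ?thesis by (simp add: int)
qed

end

section \<open>The dominant root\<close>

text \<open>The quotient of \<open>\<Sum>j<k. t ^ j\<close> by \<open>t ^ k\<close> decreases strictly in \<open>t > 0\<close>, so the polynomial has one
positive root and a number of larger modulus cannot be a root.\<close>

lemma kbonacci_quotient_strict:
  fixes s t :: real
  assumes "0 < s" "s < t" "k > 0"
  shows "(\<Sum>j<k. t ^ j) * s ^ k < (\<Sum>j<k. s ^ j) * t ^ k"
  unfolding sum_distrib_right
proof (rule sum_strict_mono)
  fix j assume "j \<in> {..<k}"
  hence j: "j < k" by simp
  then obtain d where d: "k = j + d" "d > 0" using less_imp_add_positive by blast
  have eq: "t ^ j * s ^ k = (t * s) ^ j * s ^ d" "s ^ j * t ^ k = (t * s) ^ j * t ^ d"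
    by (simp_all add: d(1) power_add power_mult_distrib mult_ac)
  have "s ^ d < t ^ d" using assms d(2) by (intro power_strict_mono) auto
  thus "t ^ j * s ^ k < s ^ j * t ^ k" unfolding eq using assms by (intro mult_strict_left_mono) auto
qed (use assms in auto)

text \<open>The intermediate value theorem gives a root \<open>t\<close> in \<open>(1, 2]\<close>. If it were not \<open>\<beta>\<close>, then
\<open>\<bar>\<beta>\<bar>\<close> would exceed \<open>t\<close>, which is impossible for a root.\<close>

lemma kbonacci_dominant_root:
  assumes k: "k \<ge> 2" and dom: "dominant_root (kbonacci_poly k) (complex_of_real \<beta>)"
  shows "\<beta> > 1 \<and> \<beta> ^ k = (\<Sum>j<k. \<beta> ^ j)"
proof -
  have root_iff: "poly (kbonacci_poly k) (complex_of_real t) = 0 \<longleftrightarrow> t ^ k = (\<Sum>j<k. t ^ j)" for t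
  proof -
    have "poly (kbonacci_poly k) (complex_of_real t) = complex_of_real (t ^ k - (\<Sum>j<k. t ^ j))"
      by (simp add: kbonacci_poly_def poly_monom poly_sum)
    thus ?thesis by (simp only: of_real_eq_0_iff right_minus_eq)
  qed
  have root: "\<beta> ^ k = (\<Sum>j<k. \<beta> ^ j)" using dom root_iff by (simp add: dominant_root_def)
  have "(\<Sum>j<k. (2::real) ^ j) = 2 ^ k - 1" using geometric_sum[of "2::real" k] by simp
  hence "\<exists>t. 1 \<le> t \<and> t \<le> 2 \<and> t ^ k - (\<Sum>j<k. t ^ j) = (0::real)"
    using k by (intro IVT) (auto intro!: continuous_intros)
  then obtain t :: real where t: "1 \<le> t" "t ^ k = (\<Sum>j<k. t ^ j)" by auto
  have "t \<noteq> 1" using t(2) k by auto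
  hence t1: "t > 1" using t(1) by simp
  show ?thesis
  proof (cases "\<beta> = t")
    case False
    have "cmod (complex_of_real t) < cmod (complex_of_real \<beta>)"
      using dom root_iff[of t] t(2) False unfolding dominant_root_def by (metis of_real_eq_iff)
    hence lt: "t < \<bar>\<beta>\<bar>" using t1 by simp
    have "\<bar>\<beta>\<bar> ^ k \<le> (\<Sum>j<k. \<bar>\<beta>\<bar> ^ j)"
      unfolding power_abs[symmetric] root by (rule sum_abs)
    moreover have "(\<Sum>j<k. \<bar>\<beta>\<bar> ^ j) * t ^ k < t ^ k * \<bar>\<beta>\<bar> ^ k"
      using kbonacci_quotient_strict[OF _ lt, of k] t1 k t(2) by simp
    ultimately have False using t1 by (simp add: mult.commute)
    thus ?thesis ..
  qed (use t1 root in simp)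
qed

theorem theorem1:
  fixes k :: nat and \<beta> :: real
  assumes "k \<ge> 2"
    and "dominant_root (kbonacci_poly k) (complex_of_real \<beta>)"
  shows "\<exists>U :: (nat \<Rightarrow> nat) \<Rightarrow> real.
    continuous_on (seqs k) U \<and> (\<forall>x\<in>seqs k. 0 \<le> U x) \<and>
    (\<forall>x\<in>seqs k. renorm k U x = U x) \<and>
    (\<forall>x\<in>seqs k. U x =
      (case delta k x of
         enat m \<Rightarrow> ln (1 + letter_weight k \<beta> (x 0) /
           (\<beta> / (\<beta> - 1)
            + (\<Sum>l<k. letter_weight k \<beta> l * real (count_list (map x [0..<m]) l))
            - letter_weight k \<beta> (x 0)))
       | \<infinity> \<Rightarrow> 0)) \<and>
    (\<forall>(V :: (nat \<Rightarrow> nat) \<Rightarrow> real) (g :: (nat \<Rightarrow> nat) \<Rightarrow> real)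
       (h :: (nat \<Rightarrow> nat) \<Rightarrow> real) (\<alpha> :: real).
      (\<forall>x\<in>seqs k. 0 \<le> V x) \<and>
      (\<forall>x\<in>seqs k. V x = g x * inv_delta_powr k \<alpha> x + h x * inv_delta_powr k \<alpha> x) \<and>
      continuous_on (seqs k) g \<and> (\<forall>x\<in>seqs k. 0 < g x) \<and>
      continuous_on (seqs k) h \<and> (\<forall>x\<in>subst_space k. h x = 0) \<and>
      0 < \<alpha> \<longrightarrow>
      (\<forall>x\<in>seqs k - subst_space k.
        (\<alpha> > 1 \<longrightarrow> (\<lambda>n. (renorm k ^^ n) V x) \<longlonglongrightarrow> 0) \<and>
        (\<alpha> < 1 \<longrightarrow> filterlim (\<lambda>n. (renorm k ^^ n) V x) at_top sequentially) \<and>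
        (\<alpha> = 1 \<longrightarrow> (\<forall>\<mu>. ergodic_prob_on (subst_space k) shift_seq \<mu> \<longrightarrow>
           (\<lambda>n. (renorm k ^^ n) V x) \<longlonglongrightarrow> (\<integral>y. g y \<partial>\<mu>) * U x))))"
proof -
  interpret kbonacci_root k \<beta>
    using assms(1) kbonacci_dominant_root[OF assms] by unfold_locales auto
  show ?thesis
  proof (rule exI[of _ fixed_potential], intro conjI allI impI ballI)
    fix x assume x: "x \<in> seqs k"
    show "fixed_potential x = (case delta k x of
         enat m \<Rightarrow> ln (1 + letter_weight k \<beta> (x 0) /
           (\<beta> / (\<beta> - 1)
            + (\<Sum>l<k. letter_weight k \<beta> l * real (count_list (map x [0..<m]) l))
            - letter_weight k \<beta> (x 0)))
       | \<infinity> \<Rightarrow> 0)"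
      by (simp only: fixed_potential_def total_weight_def sum_letter_counts[OF x])
  next
    fix V g h :: "(nat \<Rightarrow> nat) \<Rightarrow> real" and \<alpha> :: real and x
    assume *: "(\<forall>x\<in>seqs k. 0 \<le> V x) \<and>
      (\<forall>x\<in>seqs k. V x = g x * inv_delta_powr k \<alpha> x + h x * inv_delta_powr k \<alpha> x) \<and>
      continuous_on (seqs k) g \<and> (\<forall>x\<in>seqs k. 0 < g x) \<and>
      continuous_on (seqs k) h \<and> (\<forall>x\<in>subst_space k. h x = 0) \<and> 0 < \<alpha>"
      and x: "x \<in> seqs k - subst_space k"
    obtain m where m: "exits_at m x" using exits_at_exists x by blast
    interpret kbonacci_exit k \<beta> x m using x m by unfold_locales auto
    have V: "\<forall>y\<in>seqs k. V y = g y * inv_delta_powr k \<alpha> y + h y * inv_delta_powr k \<alpha> y"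
        "\<forall>y\<in>seqs k. 0 \<le> V y"
      using * by auto
    have V': "\<forall>y\<in>seqs k. V y = (g y + h y) * inv_delta_powr k \<alpha> y"
      using V(1) by (simp add: distrib_right)
    have g: "continuous_on (seqs k) g" "\<forall>y\<in>seqs k. 0 < g y"
      and h: "continuous_on (seqs k) h" "\<forall>y\<in>subst_space k. h y = 0" and "0 < \<alpha>"
      using * by auto
    show "(\<lambda>n. (renorm k ^^ n) V x) \<longlonglongrightarrow> 0" if "\<alpha> > 1"
      by (rule limit_fast_decay[OF V(2) V' continuous_on_add[OF g(1) h(1)] that])
    show "filterlim (\<lambda>n. (renorm k ^^ n) V x) at_top sequentially" if "\<alpha> < 1"
      by (rule limit_slow_decay[OF V(1) g h \<open>0 < \<alpha>\<close> that])
    show "(\<lambda>n. (renorm k ^^ n) V x) \<longlonglongrightarrow> (\<integral>y. g y \<partial>\<mu>) * fixed_potential x"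
      if "\<alpha> = 1" "ergodic_prob_on (subst_space k) shift_seq \<mu>" for \<mu>
      by (rule limit_critical_decay[OF V(1)[unfolded that(1)] g(1) h that(2)])
  qed (fact continuous_fixed_potential fixed_potential_nonneg renorm_fixed_potential)+
qed

end
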